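(* For each $\varepsilon > 0$ there exists a constant $C = C(\varepsilon)$ such that the following holds. If $p = p(n)$ and $q = q(n) = 1 - p(n)$ satisfy $n^{-1}\log n \ll q \ll n^{-2/3}$, then $$\mathbb{P}\Big( \big| \chi\big( G(n,p) \big) - \mathbb{E}\big[ \chi\big( G(n,p) \big) \big] \big| \ge C n^{3/2} q^{3/2} \Big) \le \varepsilon$$ for all sufficiently large $n \in \mathbb{N}$.
   Context: $G(n,p)$ is the binomial random graph on $n$ labelled vertices, in which each pair is an edge independently with probability $p$; $\chi$ denotes the chromatic number. For functions of $n$, $f \ll g$ means $f(n)/g(n) \to 0$ as $n \to \infty$. *)

theory Defs
  imports
    "HOL-Probability.Probability"
    "HOL-Probability.Product_PMF"
    "HOL-Library.Landau_Symbols"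
begin

text \<open>
  A finite simple graph is given by a vertex set and a set of edges, each edge being
  a two-element set of vertices.
\<close>

definition vertex_pairs :: "'a set \<Rightarrow> 'a set set" where
  "vertex_pairs V = {e. e \<subseteq> V \<and> card e = 2}"

definition proper_colouring :: "'a set \<Rightarrow> 'a set set \<Rightarrow> nat \<Rightarrow> ('a \<Rightarrow> nat) \<Rightarrow> bool" where
  "proper_colouring V E k c \<longleftrightarrow>
     c ` V \<subseteq> {..<k} \<and> (\<forall>u\<in>V. \<forall>v\<in>V. {u, v} \<in> E \<longrightarrow> c u \<noteq> c v)"

definition chromatic_number :: "'a set \<Rightarrow> 'a set set \<Rightarrow> nat" where
  "chromatic_number V E = (LEAST k. \<exists>c. proper_colouring V E k c)"

text \<open>
  The binomial random graph on the vertex set \<open>{..<n}\<close>, as a distribution of edge sets: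
  one independent coin with success probability \<open>p\<close> per vertex pair. It has the intended
  meaning only for \<open>0 \<le> p \<le> 1\<close>, since \<^const>\<open>bernoulli_pmf\<close> clamps its parameter.
\<close>

definition gnp :: "nat \<Rightarrow> real \<Rightarrow> nat set set pmf" where
  "gnp n p = map_pmf (\<lambda>X. {e \<in> vertex_pairs {..<n}. X e})
     (Pi_pmf (vertex_pairs {..<n}) False (\<lambda>_. bernoulli_pmf p))"

text \<open>
  The least number of colours is attained for every finite simple graph, so \<open>LEAST\<close>
  above never ranges over an empty set in the cases of interest.
\<close>

lemma ex_proper_colouring_chromatic_number:
  assumes "finite V" and "E \<subseteq> vertex_pairs V"
  shows "\<exists>c. proper_colouring V E (chromatic_number V E) c"
proof -
  obtain c where "bij_betw c V {0..<card V}"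
    using ex_bij_betw_finite_nat[OF assms(1)] by blast
  then have c: "inj_on c V" "c ` V = {..<card V}"
    by (simp_all add: bij_betw_def atLeast0LessThan)
  have "proper_colouring V E (card V) c"
    unfolding proper_colouring_def
  proof (intro conjI ballI impI)
    fix u v assume uv: "u \<in> V" "v \<in> V" "{u, v} \<in> E"
    then have "card {u, v} = 2"
      using assms(2) by (auto simp: vertex_pairs_def)
    then have "u \<noteq> v" by auto
    then show "c u \<noteq> c v" using inj_on_eq_iff[OF c(1) uv(1,2)] by simp
  qed (use c(2) in simp)
  then have "\<exists>k c. proper_colouring V E k c" by (intro exI)
  then show ?thesis
    unfolding chromatic_number_def by (rule LeastI_ex)
qed

end

theory Submission
  imports Defs
begin

text \<open>
  A colour class of \<open>G = G(n,p)\<close> is a clique of the complement \<open>H\<close>, in which each pair is an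
  edge independently with probability \<open>q\<close>. The argument therefore takes place in the sparse
  random graph \<open>H\<close>, and \<open>\<chi>(G)\<close> is the least number of cliques of \<open>H\<close> that partition the
  vertices. Since \<open>q \<ll> n\<^sup>-\<^sup>2\<^sup>/\<^sup>3\<close>, triangles of \<open>H\<close> cover few vertices; since
  \<open>q \<gg> n\<^sup>-\<^sup>1 log n\<close>, the vertices left over by any family of disjoint larger cliques have a
  perfect matching up to parity. So, with high probability, some optimal colouring consists of
  classes of size at least 3, pairs, and at most one singleton.

  This suggests replacing \<open>\<chi>\<close> by a smoother parameter \<open>\<psi>(H)\<close>, the capped cover number: the
  least value, over all partitions into cliques of \<open>H\<close>, of the sum of \<open>min 2 |K|\<close> over the
  parts \<open>K\<close>. So a singleton costs half as much as any other part. The parameter is useful for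
  two reasons.

  First, \<open>\<psi>\<close> has small variance. Adding an edge to \<open>H\<close> lowers \<open>\<psi>\<close> by at most 1, and
  does not change it at all unless the edge closes a triangle, because a part that consists of
  just the two ends of the edge costs as much as two singletons. A given pair closes a triangle with
  probability at most \<open>n q\<^sup>2\<close>, so the Efron--Stein inequality
  (\<open>efron_stein_random_subset\<close>) bounds the variance of \<open>\<psi>\<close> by
  \<open>q \<cdot> n\<^sup>2/2 \<cdot> n q\<^sup>2 = (n q)\<^sup>3/2\<close> (\<open>variance_capped_cover_number_le\<close>). This is where the
  scale \<open>n\<^sup>3\<^sup>/\<^sup>2 q\<^sup>3\<^sup>/\<^sup>2\<close> comes from.

  Secondly, \<open>\<psi> \<le> 2 \<chi>\<close> always, and \<open>2 \<chi> \<le> \<psi> + 1\<close> if \<open>H\<close> is pseudorandom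
  (\<open>twice_chromatic_number_le_capped_cover_number\<close>). Here an optimal partition for \<open>\<psi>\<close> is
  kept on its parts of size at least 3; the remaining set \<open>U\<close> of vertices is cut at a suitable
  threshold into an initial half \<open>A\<close> and a final half \<open>B\<close>, and Hall's theorem matches \<open>A\<close>
  into \<open>B\<close>. Hall's condition holds since every vertex keeps more neighbours on the other side
  than are possible on average between two sets of about \<open>n/4\<close> vertices or fewer.

  The graph \<open>H\<close> fails to be pseudorandom with probability at most \<open>1/n\<close>
  (\<open>prob_not_pseudorandom\<close>). As \<open>0 \<le> 2 \<chi> - \<psi> \<le> 2 n\<close> in any case, the exceptional event changes
  the expectation by \<open>O(1)\<close> only, so Chebyshev's inequality for \<open>\<psi>\<close> gives the theorem.
\<close>

section \<open>Random subsets of a finite set\<close>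

text \<open>
  Up to the choice of ground set this is the edge set of the binomial random graph: \<open>gnp n p\<close>
  is \<open>random_subset (vertex_pairs {..<n}) p\<close>. Working with an arbitrary ground set permits
  induction on it, which exposes one element at a time.
\<close>
definition random_subset :: "'a set \<Rightarrow> real \<Rightarrow> 'a set pmf" where
  "random_subset A q = map_pmf (\<lambda>X. {a \<in> A. X a}) (Pi_pmf A False (\<lambda>_. bernoulli_pmf q))"

lemma set_pmf_random_subset: "set_pmf (random_subset A q) \<subseteq> Pow A"
  by (auto simp: random_subset_def)

lemma finite_set_pmf_random_subset:
  "finite A \<Longrightarrow> finite (set_pmf (random_subset A q))"
  using set_pmf_random_subset finite_subset by (metis finite_Pow_iff)

lemma integrable_random_subset [intro, simp]:
  fixes f :: "'a set \<Rightarrow> real"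
  shows "finite A \<Longrightarrow> integrable (measure_pmf (random_subset A q)) f"
  by (intro integrable_measure_pmf_finite finite_set_pmf_random_subset)

lemma expectation_random_subset_mono:
  fixes f g :: "'a set \<Rightarrow> real"
  assumes "finite A" "\<And>H. H \<subseteq> A \<Longrightarrow> f H \<le> g H"
  shows "measure_pmf.expectation (random_subset A q) f
    \<le> measure_pmf.expectation (random_subset A q) g"
  using assms set_pmf_random_subset[of A q]
  by (intro integral_mono_AE) (auto simp: AE_measure_pmf_iff)

lemma random_subset_empty: "random_subset {} q = return_pmf {}"
  by (simp add: random_subset_def)

text \<open>
  Exposing the element \<open>a\<close> first: the recursion behind every induction on the ground set.
\<close>
lemma random_subset_insert:
  assumes "finite A" "a \<notin> A"
  shows "random_subset (insert a A) q = bind_pmf (bernoulli_pmf q)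
    (\<lambda>b. map_pmf (\<lambda>H. if b then insert a H else H) (random_subset A q))"
proof -
  have eq: "{x \<in> insert a A. (f(a := b)) x} = (if b then insert a {x \<in> A. f x} else {x \<in> A. f x})"
    for f b using assms(2) by auto
  show ?thesis
    unfolding random_subset_def Pi_pmf_insert'[OF assms] map_bind_pmf map_return_pmf eq
    by (simp add: map_pmf_def bind_assoc_pmf bind_return_pmf)
qed

text \<open>
  For graphs: the complement of \<open>G(n,q)\<close> is \<open>G(n,1-q)\<close>.
\<close>
lemma random_subset_compl:
  assumes "finite A" "0 \<le> q" "q \<le> 1"
  shows "map_pmf ((-) A) (random_subset A q) = random_subset A (1 - q)"
  using assms(1)
proof (induction A rule: finite_induct)
  case empty
  then show ?case by (simp add: random_subset_empty)
next
  case (insert a A)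
  have flip: "bernoulli_pmf (1 - q) = map_pmf Not (bernoulli_pmf q)"
  proof (rule pmf_eqI)
    fix b
    have "pmf (map_pmf Not (bernoulli_pmf q)) (\<not> \<not> b) = pmf (bernoulli_pmf q) (\<not> b)"
      by (rule pmf_map_inj') (auto simp: inj_def)
    then show "pmf (bernoulli_pmf (1 - q)) b = pmf (map_pmf Not (bernoulli_pmf q)) b"
      using assms by (cases b) auto
  qed
  have "map_pmf ((-) (insert a A)) (random_subset (insert a A) q)
      = bind_pmf (bernoulli_pmf q) (\<lambda>b. map_pmf (\<lambda>H. insert a A - (if b then insert a H else H))
          (random_subset A q))"
    by (simp add: random_subset_insert[OF insert.hyps] map_bind_pmf pmf.map_comp o_def)
  also have "\<dots> = bind_pmf (bernoulli_pmf q) (\<lambda>b. map_pmf (\<lambda>H. if \<not> b then insert a (A - H) else A - H)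
          (random_subset A q))"
    using insert.hyps set_pmf_random_subset[of A q]
    by (intro bind_pmf_cong map_pmf_cong refl) (auto simp: subset_iff)
  also have "\<dots> = bind_pmf (bernoulli_pmf q) (\<lambda>b. map_pmf (\<lambda>H. if \<not> b then insert a H else H)
          (map_pmf ((-) A) (random_subset A q)))"
    by (simp add: pmf.map_comp o_def)
  also have "\<dots> = random_subset (insert a A) (1 - q)"
    unfolding insert.IH random_subset_insert[OF insert.hyps] flip
    by (simp add: bind_map_pmf)
  finally show ?case .
qed

lemma expectation_random_subset_insert:
  fixes f :: "'a set \<Rightarrow> real"
  assumes "finite A" "a \<notin> A" "0 \<le> q" "q \<le> 1"
  shows "measure_pmf.expectation (random_subset (insert a A) q) f =
    q * measure_pmf.expectation (random_subset A q) (\<lambda>H. f (insert a H))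
    + (1 - q) * measure_pmf.expectation (random_subset A q) f"
  unfolding random_subset_insert[OF assms(1,2)]
  by (subst pmf_expectation_bind[where A = UNIV])
     (use assms in \<open>auto simp: UNIV_bool finite_set_pmf_random_subset\<close>)

text \<open>
  Independence, in the form that yields both the probability of containing a given set and the
  moment generating function of the number of chosen elements of a given set.
\<close>
lemma expectation_random_subset_prod:
  fixes h :: "'a \<Rightarrow> bool \<Rightarrow> real"
  assumes "finite A" "0 \<le> q" "q \<le> 1"
  shows "measure_pmf.expectation (random_subset A q) (\<lambda>H. \<Prod>a\<in>A. h a (a \<in> H)) =
    (\<Prod>a\<in>A. q * h a True + (1 - q) * h a False)"
  using assms(1)
proof (induction A rule: finite_induct)
  case empty
  then show ?case by (simp add: random_subset_empty)
next
  case (insert a A)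
  let ?E = "measure_pmf.expectation (random_subset A q)"
  have 1: "?E (\<lambda>H. \<Prod>x\<in>insert a A. h x (x \<in> insert a H))
      = h a True * ?E (\<lambda>H. \<Prod>x\<in>A. h x (x \<in> H))"
  proof -
    have "(\<Prod>x\<in>insert a A. h x (x \<in> insert a H)) = h a True * (\<Prod>x\<in>A. h x (x \<in> H))" for H
    proof -
      have "(\<Prod>x\<in>A. h x (x \<in> insert a H)) = (\<Prod>x\<in>A. h x (x \<in> H))"
      proof (intro prod.cong refl)
        fix x assume "x \<in> A"
        then have "x \<in> insert a H \<longleftrightarrow> x \<in> H" using insert.hyps by auto
        then show "h x (x \<in> insert a H) = h x (x \<in> H)" by simp
      qed
      then show ?thesis using insert.hyps by simp
    qed
    then show ?thesis by simp
  qed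
  have 2: "?E (\<lambda>H. \<Prod>x\<in>insert a A. h x (x \<in> H)) = h a False * ?E (\<lambda>H. \<Prod>x\<in>A. h x (x \<in> H))"
  proof -
    have "?E (\<lambda>H. \<Prod>x\<in>insert a A. h x (x \<in> H)) = ?E (\<lambda>H. h a False * (\<Prod>x\<in>A. h x (x \<in> H)))"
    proof (intro integral_cong_AE AE_pmfI)
      fix H assume "H \<in> set_pmf (random_subset A q)"
      then have "a \<notin> H" using insert.hyps set_pmf_random_subset[of A q] by auto
      then show "(\<Prod>x\<in>insert a A. h x (x \<in> H)) = h a False * (\<Prod>x\<in>A. h x (x \<in> H))"
        using insert.hyps by simp
    qed auto
    then show ?thesis by simp
  qed
  show ?case
    unfolding expectation_random_subset_insert[OF insert.hyps assms(2,3)] 1 2 insert.IH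
    using insert.hyps by (simp add: algebra_simps)
qed

lemma prob_subset_random_subset:
  assumes "finite A" "0 \<le> q" "q \<le> 1" "F \<subseteq> A"
  shows "measure_pmf.prob (random_subset A q) {H. F \<subseteq> H} = q ^ card F"
proof -
  let ?h = "\<lambda>a b. if a \<in> F then of_bool b else (1 :: real)"
  have fF: "finite F" using assms finite_subset by blast
  have "indicator {H. F \<subseteq> H} H = (\<Prod>a\<in>A. ?h a (a \<in> H))" for H
  proof (cases "F \<subseteq> H")
    case True
    then have "(\<Prod>a\<in>A. ?h a (a \<in> H)) = 1" by (intro prod.neutral) auto
    then show ?thesis using True by simp
  next
    case False
    then obtain x where "x \<in> F" "x \<notin> H" by blast
    then have "(\<Prod>a\<in>A. ?h a (a \<in> H)) = 0"
      using assms by (intro prod_zero) auto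
    then show ?thesis using False by simp
  qed
  then have ind: "(\<lambda>H. \<Prod>a\<in>A. ?h a (a \<in> H)) = indicator {H. F \<subseteq> H}" by auto
  have "measure_pmf.prob (random_subset A q) {H. F \<subseteq> H} =
      measure_pmf.expectation (random_subset A q) (\<lambda>H. \<Prod>a\<in>A. ?h a (a \<in> H))"
    unfolding ind by simp
  also have "\<dots> = (\<Prod>a\<in>A. if a \<in> F then q else 1)"
    unfolding expectation_random_subset_prod[OF assms(1-3), of ?h] by (intro prod.cong) auto
  also have "\<dots> = q ^ card F"
    using assms fF by (simp add: prod.If_cases Int_absorb1)
  finally show ?thesis .
qed

lemma mgf_random_subset:
  fixes l q :: real
  assumes "finite A" "0 \<le> q" "q \<le> 1" "F \<subseteq> A"
  shows "measure_pmf.expectation (random_subset A q) (\<lambda>H. exp (l * card (F \<inter> H)))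
    \<le> exp (card F * q * (exp l - 1))"
proof -
  let ?h = "\<lambda>a b. if a \<in> F \<and> b then exp l else (1 :: real)"
  have fF: "finite F" using assms finite_subset by blast
  have "exp (l * card (F \<inter> H)) = (\<Prod>a\<in>A. ?h a (a \<in> H))" for H
  proof -
    have "(\<Prod>a\<in>A. ?h a (a \<in> H)) = exp l ^ card (A \<inter> {a. a \<in> F \<and> a \<in> H})"
      using assms by (simp add: prod.If_cases)
    also have "A \<inter> {a. a \<in> F \<and> a \<in> H} = F \<inter> H" using assms by auto
    finally show ?thesis by (simp add: exp_of_nat2_mult)
  qed
  then have "measure_pmf.expectation (random_subset A q) (\<lambda>H. exp (l * card (F \<inter> H))) =
      measure_pmf.expectation (random_subset A q) (\<lambda>H. \<Prod>a\<in>A. ?h a (a \<in> H))"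
    by simp
  also have "\<dots> = (\<Prod>a\<in>A. if a \<in> F then 1 + q * (exp l - 1) else 1)"
    unfolding expectation_random_subset_prod[OF assms(1-3), of ?h]
    by (intro prod.cong) (auto simp: algebra_simps)
  also have "\<dots> = (1 + q * (exp l - 1)) ^ card F"
    using assms fF by (simp add: prod.If_cases Int_absorb1)
  also have "\<dots> \<le> exp (q * (exp l - 1)) ^ card F"
  proof (rule power_mono)
    have "1 + q * (exp l - 1) = (1 - q) + q * exp l" by (simp add: algebra_simps)
    moreover have "0 \<le> (1 - q) + q * exp l" using assms by simp
    ultimately show "0 \<le> 1 + q * (exp l - 1)" by linarith
  qed (simp add: exp_ge_add_one_self)
  also have "\<dots> = exp (card F * q * (exp l - 1))"
    by (simp add: mult.assoc flip: exp_of_nat_mult)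
  finally show ?thesis .
qed

text \<open>
  For \<open>l > 0\<close> the event is the upper tail \<open>x \<le> card (F \<inter> H)\<close>, for \<open>l < 0\<close> it is the
  lower tail \<open>card (F \<inter> H) \<le> x\<close>; both come from Markov's inequality for the exponential.
\<close>
lemma chernoff_random_subset:
  fixes l q x :: real
  assumes "finite A" "0 \<le> q" "q \<le> 1" "F \<subseteq> A"
  shows "measure_pmf.prob (random_subset A q) {H. l * x \<le> l * card (F \<inter> H)}
    \<le> exp (card F * q * (exp l - 1) - l * x)"
proof -
  let ?\<mu> = "measure_pmf (random_subset A q)"
  have "measure_pmf.prob (random_subset A q) {H. l * x \<le> l * card (F \<inter> H)}
      = measure ?\<mu> {H \<in> space ?\<mu>. exp (l * x) \<le> exp (l * card (F \<inter> H))}" by simp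
  also have "\<dots> \<le> measure_pmf.expectation (random_subset A q) (\<lambda>H. exp (l * card (F \<inter> H))) / exp (l * x)"
    by (rule integral_Markov_inequality_measure[where A = UNIV]) (use assms in auto)
  also have "\<dots> \<le> exp (card F * q * (exp l - 1)) / exp (l * x)"
    by (intro divide_right_mono mgf_random_subset assms) auto
  finally show ?thesis by (simp add: exp_diff)
qed

section \<open>Disjoint copies of a rare configuration\<close>

text \<open>
  With \<open>M\<close> candidates of probability \<open>x\<close> each, the union bound for \<open>k\<close> independent successes
  is \<open>(M choose k) x\<^sup>k \<le> (e M x / k)\<^sup>k\<close>, which is at most \<open>e\<^sup>-\<^sup>k\<close> once \<open>k\<close> exceeds
  the mean \<open>M x\<close> by the factor \<open>e\<^sup>2\<close>.
\<close>
lemma choose_mult_power_le: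
  fixes x :: real
  assumes "0 \<le> x" "exp 2 * (real M * x) \<le> k"
  shows "real (M choose k) * x ^ k \<le> exp (- real k)"
proof -
  \<comment> \<open>the single term \<open>k\<^sup>k / k!\<close> of the exponential series of \<open>k\<close>\<close>
  have term_le: "real k ^ k / fact k \<le> exp (real k)"
    using sum_le_suminf[OF sums_summable[OF exp_converges[of "real k"]], of "{k}"] exp_converges[of "real k"]
    by (simp add: sums_iff divide_inverse mult.commute scaleR_conv_of_real)
  have "real ((M choose k) * fact k) \<le> real (M ^ k)"
    by (intro of_nat_mono binomial_fact_pow)
  then have "real (M choose k) \<le> real M ^ k / fact k"
    by (simp add: field_simps)
  then have "real (M choose k) * x ^ k \<le> real M ^ k / fact k * x ^ k"
    using assms by (intro mult_right_mono) auto
  also have "\<dots> = (real M * x) ^ k / fact k" by (simp add: power_mult_distrib)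
  also have "\<dots> \<le> (real k / exp 2) ^ k / fact k"
    using assms by (intro divide_right_mono power_mono) (auto simp: field_simps)
  also have "\<dots> = (real k ^ k / fact k) * exp (- 2 * real k)"
    using exp_of_nat2_mult[of "2 :: real" k]
    by (simp add: power_divide power_mult_distrib power_inverse exp_minus divide_inverse mult.commute)
  also have "\<dots> \<le> exp (real k) * exp (- 2 * real k)"
    by (intro mult_right_mono term_le) auto
  also have "\<dots> = exp (- real k)" by (simp flip: exp_add)
  finally show ?thesis .
qed

text \<open>
  Disjointness is what makes the events \<open>F \<subseteq> H\<close> for the members \<open>F\<close> of the family
  independent.
\<close>
definition packs :: "'a set set \<Rightarrow> nat \<Rightarrow> 'a set \<Rightarrow> bool" where
  "packs \<Gamma> k H \<longleftrightarrow> (\<exists>\<F>\<subseteq>\<Gamma>. card \<F> = k \<and> disjoint \<F> \<and> \<Union>\<F> \<subseteq> H)"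

lemma prob_packs_le_binomial:
  assumes A: "finite A" "0 \<le> q" "q \<le> 1"
    and \<Gamma>: "\<Gamma> \<subseteq> Pow A" "\<And>F. F \<in> \<Gamma> \<Longrightarrow> card F = r"
  shows "measure_pmf.prob (random_subset A q) {H. packs \<Gamma> k H} \<le> real (card \<Gamma> choose k) * (q ^ r) ^ k"
proof -
  let ?P = "measure_pmf.prob (random_subset A q)"
  have fin: "finite \<Gamma>" using A \<Gamma> finite_subset by blast
  define I where "I = {\<F>. \<F> \<subseteq> \<Gamma> \<and> card \<F> = k}"
  have "finite I" using fin unfolding I_def by simp
  define J where "J = {\<F> \<in> I. disjoint \<F>}"
  have "{H. packs \<Gamma> k H} \<subseteq> (\<Union>\<F>\<in>J. {H. \<Union>\<F> \<subseteq> H})"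
    by (auto simp: packs_def J_def I_def)
  then have "?P {H. packs \<Gamma> k H} \<le> ?P (\<Union>\<F>\<in>J. {H. \<Union>\<F> \<subseteq> H})"
    by (intro measure_pmf.finite_measure_mono) auto
  also have "\<dots> \<le> (\<Sum>\<F>\<in>J. ?P {H. \<Union>\<F> \<subseteq> H})"
    by (rule measure_pmf.finite_measure_subadditive_finite) (use \<open>finite I\<close> in \<open>auto simp: J_def\<close>)
  also have "\<dots> = (\<Sum>\<F>\<in>J. (q ^ r) ^ k)"
  proof (rule sum.cong)
    fix \<F> assume "\<F> \<in> J"
    then have \<F>: "\<F> \<subseteq> \<Gamma>" "card \<F> = k" "disjoint \<F>" by (auto simp: J_def I_def)
    have "card (\<Union>\<F>) = sum card \<F>"
    proof (rule card_Union_disjoint)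
      fix F assume "F \<in> \<F>"
      then have "F \<subseteq> A" using \<F> \<Gamma> by blast
      then show "finite F" using A finite_subset by blast
    qed fact
    also have "\<dots> = r * k" using \<F> \<Gamma>(2) by (simp add: subset_iff)
    finally have "card (\<Union>\<F>) = r * k" .
    moreover have "\<Union>\<F> \<subseteq> A" using \<F> \<Gamma> by auto
    ultimately show "?P {H. \<Union>\<F> \<subseteq> H} = (q ^ r) ^ k"
      using prob_subset_random_subset[OF A] by (simp add: power_mult)
  qed simp
  also have "\<dots> = real (card J) * (q ^ r) ^ k" by simp
  also have "\<dots> \<le> real (card I) * (q ^ r) ^ k"
    using A \<open>finite I\<close> by (intro mult_right_mono) (auto simp: J_def intro!: card_mono)
  also have "card I = card \<Gamma> choose k"
    unfolding I_def using n_subsets[OF fin] by simp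
  finally show ?thesis .
qed

lemma prob_packs_le_exp:
  assumes "finite A" "0 \<le> q" "q \<le> 1"
    and "\<Gamma> \<subseteq> Pow A" "\<And>F. F \<in> \<Gamma> \<Longrightarrow> card F = r"
    and "exp 2 * (real (card \<Gamma>) * q ^ r) \<le> k"
  shows "measure_pmf.prob (random_subset A q) {H. packs \<Gamma> k H} \<le> exp (- real k)"
  using prob_packs_le_binomial[OF assms(1-5), of k] choose_mult_power_le[of "q ^ r" "card \<Gamma>" k] assms
  by simp

lemma packsI:
  assumes "finite I" "k \<le> card I" "\<And>i. i \<in> I \<Longrightarrow> g i \<in> \<Gamma>" "\<And>i. i \<in> I \<Longrightarrow> g i \<subseteq> H"
    "\<And>i. i \<in> I \<Longrightarrow> g i \<noteq> {}" "\<And>i j. i \<in> I \<Longrightarrow> j \<in> I \<Longrightarrow> i \<noteq> j \<Longrightarrow> g i \<inter> g j = {}"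
  shows "packs \<Gamma> k H"
proof -
  obtain J where J: "J \<subseteq> I" "card J = k" using assms(1,2) by (meson obtain_subset_with_card_n)
  have "inj_on g J"
  proof (rule inj_onI, rule ccontr)
    fix i j assume "i \<in> J" "j \<in> J" "g i = g j" "i \<noteq> j"
    then show False using assms(5)[of i] assms(6)[of i j] J by auto
  qed
  moreover have "disjoint (g ` J)"
  proof (rule disjointI)
    fix F F' assume "F \<in> g ` J" "F' \<in> g ` J" "F \<noteq> F'"
    then show "F \<inter> F' = {}" using assms(6) J by blast
  qed
  ultimately show ?thesis
    unfolding packs_def using J assms(3,4)
    by (intro exI[of _ "g ` J"]) (auto simp: card_image subset_iff)
qed

section \<open>The Efron--Stein inequality\<close>

text \<open>
  Conditioning on one element \<open>b\<close> splits the variance into the average of the two conditional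
  variances plus \<open>q (1 - q)\<close> times the square of the difference of the two conditional means.
  The induction hypothesis bounds the former, Jensen's inequality the latter.
\<close>
theorem efron_stein_random_subset:
  fixes f :: "'a set \<Rightarrow> real"
  assumes "finite A" "0 \<le> q" "q \<le> 1"
  shows "measure_pmf.variance (random_subset A q) f \<le>
    q * (1 - q) * (\<Sum>a\<in>A. measure_pmf.expectation (random_subset A q)
      (\<lambda>H. (f (insert a H) - f (H - {a}))\<^sup>2))"
  using assms(1)
proof (induction A arbitrary: f rule: finite_induct)
  case empty
  then show ?case by (simp add: random_subset_empty)
next
  case (insert b A)
  let ?E = "measure_pmf.expectation (random_subset A q)"
  let ?E' = "measure_pmf.expectation (random_subset (insert b A) q)"
  define g where "g = (\<lambda>H. f (insert b H))"
  define D where "D f a H = (f (insert a H) - f (H - {a}))\<^sup>2"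
    for f :: "'a set \<Rightarrow> real" and a H
  have [simp]: "finite A" "b \<notin> A" using insert.hyps by auto
  note split = expectation_random_subset_insert[OF insert.hyps assms(2,3)]
  have var: "measure_pmf.variance (random_subset A q) h = ?E (\<lambda>H. (h H)\<^sup>2) - (?E h)\<^sup>2"
    for h :: "'a set \<Rightarrow> real"
    by (rule measure_pmf.variance_eq) auto
  have IH: "?E (\<lambda>H. (h H)\<^sup>2) - (?E h)\<^sup>2 \<le> q * (1 - q) * (\<Sum>a\<in>A. ?E (D h a))"
    for h
    using insert.IH[of h] unfolding var D_def by simp
  have old: "?E' (D f a) = q * ?E (D g a) + (1 - q) * ?E (D f a)" if "a \<in> A" for a
  proof -
    have "D f a (insert b H) = D g a H" for H
    proof -
      have "a \<noteq> b" using that insert.hyps by auto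
      then have "insert b H - {a} = insert b (H - {a})" by auto
      then show ?thesis by (simp add: D_def g_def insert_commute)
    qed
    then show ?thesis unfolding split by simp
  qed
  have new: "?E' (D f b) = ?E (\<lambda>H. (g H - f H)\<^sup>2)"
  proof -
    have "D f b (insert b H) = (g H - f H)\<^sup>2" "D f b H = (g H - f H)\<^sup>2"
      if "H \<in> set_pmf (random_subset A q)" for H
    proof -
      have "b \<notin> H" using that insert.hyps set_pmf_random_subset[of A q] by blast
      then show "D f b (insert b H) = (g H - f H)\<^sup>2" "D f b H = (g H - f H)\<^sup>2"
        by (simp_all add: D_def g_def)
    qed
    then have "?E (\<lambda>H. D f b (insert b H)) = ?E (\<lambda>H. (g H - f H)\<^sup>2)"
      "?E (D f b) = ?E (\<lambda>H. (g H - f H)\<^sup>2)"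
      by (intro integral_cong_AE AE_pmfI; simp)+
    then show ?thesis unfolding split by (simp add: algebra_simps)
  qed
  have jensen: "(?E g - ?E f)\<^sup>2 \<le> ?E (\<lambda>H. (g H - f H)\<^sup>2)"
  proof -
    have "0 \<le> measure_pmf.variance (random_subset A q) (\<lambda>H. g H - f H)"
      by (rule Bochner_Integration.integral_nonneg) auto
    then show ?thesis unfolding var by simp
  qed
  have "measure_pmf.variance (random_subset (insert b A) q) f = ?E' (\<lambda>H. (f H)\<^sup>2) - (?E' f)\<^sup>2"
    by (rule measure_pmf.variance_eq) auto
  also have "\<dots> = q * (?E (\<lambda>H. (g H)\<^sup>2) - (?E g)\<^sup>2) + (1 - q) * (?E (\<lambda>H. (f H)\<^sup>2) - (?E f)\<^sup>2)
      + q * (1 - q) * (?E g - ?E f)\<^sup>2"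
    unfolding split g_def[symmetric] by (simp add: g_def) (simp add: algebra_simps power2_eq_square)
  also have "\<dots> \<le> q * (q * (1 - q) * (\<Sum>a\<in>A. ?E (D g a))) + (1 - q) * (q * (1 - q) * (\<Sum>a\<in>A. ?E (D f a)))
      + q * (1 - q) * ?E (\<lambda>H. (g H - f H)\<^sup>2)"
    using assms by (intro add_mono mult_left_mono IH jensen) auto
  also have "\<dots> = q * (1 - q) * ((\<Sum>a\<in>A. ?E' (D f a)) + ?E' (D f b))"
    by (simp add: old new sum.distrib flip: sum_distrib_left) (simp add: algebra_simps)
  also have "\<dots> = q * (1 - q) * (\<Sum>a\<in>insert b A. ?E' (D f a))"
    by simp
  finally show ?case unfolding D_def .
qed

section \<open>The capped cover number\<close>

text \<open>
  A partition of \<open>V\<close> into cliques of \<open>H\<close>, given by labels as a colouring is. The label type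
  is left free so that labels of different kinds can be mixed when a new labelling is built.
\<close>
definition clique_labelling :: "'a set \<Rightarrow> 'a set set \<Rightarrow> ('a \<Rightarrow> 'b) \<Rightarrow> bool" where
  "clique_labelling V H c \<longleftrightarrow> (\<forall>u\<in>V. \<forall>v\<in>V. u \<noteq> v \<longrightarrow> c u = c v \<longrightarrow> {u, v} \<in> H)"

lemma clique_labellingD:
  "clique_labelling V H c \<Longrightarrow> u \<in> V \<Longrightarrow> v \<in> V \<Longrightarrow> u \<noteq> v \<Longrightarrow> c u = c v \<Longrightarrow> {u, v} \<in> H"
  by (simp add: clique_labelling_def)

definition label_class :: "'a set \<Rightarrow> ('a \<Rightarrow> 'b) \<Rightarrow> 'b \<Rightarrow> 'a set" where
  "label_class V c i = {v \<in> V. c v = i}"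

text \<open>
  Relative to the number of labels, counted twice, this forgives one unit for each singleton class.
\<close>
definition capped_cost :: "'a set \<Rightarrow> ('a \<Rightarrow> 'b) \<Rightarrow> nat" where
  "capped_cost V c = (\<Sum>i\<in>c ` V. min 2 (card (label_class V c i)))"

definition capped_cover_number :: "'a set \<Rightarrow> 'a set set \<Rightarrow> nat" where
  "capped_cover_number V H =
    (LEAST k. \<exists>c :: 'a \<Rightarrow> nat. clique_labelling V H c \<and> capped_cost V c = k)"

lemma pair_in_vertex_pairs:
  "u \<in> V \<Longrightarrow> v \<in> V \<Longrightarrow> u \<noteq> v \<Longrightarrow> {u, v} \<in> vertex_pairs V"
  by (simp add: vertex_pairs_def)

lemma chromatic_number_le_card_labels:
  assumes "finite V" "clique_labelling V H c"
  shows "chromatic_number V (vertex_pairs V - H) \<le> card (c ` V)"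
proof -
  obtain h where "bij_betw h (c ` V) {0..<card (c ` V)}"
    using ex_bij_betw_finite_nat assms(1) by blast
  then have h: "inj_on h (c ` V)" "h ` c ` V = {..<card (c ` V)}"
    by (auto simp: bij_betw_def)
  have "proper_colouring V (vertex_pairs V - H) (card (c ` V)) (h \<circ> c)"
    unfolding proper_colouring_def
  proof (intro conjI ballI impI)
    fix u v assume uv: "u \<in> V" "v \<in> V" "{u, v} \<in> vertex_pairs V - H"
    then have "u \<noteq> v" by (auto simp: vertex_pairs_def)
    then have "c u \<noteq> c v" using uv assms(2) by (auto simp: clique_labelling_def)
    then show "(h \<circ> c) u \<noteq> (h \<circ> c) v" using h(1) uv by (auto simp: inj_on_def)
  qed (use h in \<open>auto simp: image_comp\<close>)
  then show ?thesis unfolding chromatic_number_def by (intro Least_le exI)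
qed

lemma ex_clique_labelling_chromatic_number:
  assumes "finite V"
  shows "\<exists>c :: 'a \<Rightarrow> nat. clique_labelling V H c \<and> card (c ` V) \<le> chromatic_number V (vertex_pairs V - H)"
proof -
  obtain c where c: "proper_colouring V (vertex_pairs V - H) (chromatic_number V (vertex_pairs V - H)) c"
    using ex_proper_colouring_chromatic_number[OF assms] by (meson Diff_subset)
  have "clique_labelling V H c"
    using c pair_in_vertex_pairs[of _ V] unfolding clique_labelling_def proper_colouring_def
    by (metis Diff_iff)
  moreover have "card (c ` V) \<le> card {..<chromatic_number V (vertex_pairs V - H)}"
    using c by (intro card_mono) (auto simp: proper_colouring_def)
  ultimately show ?thesis by auto
qed

lemma capped_cover_number_le:
  fixes c :: "'a \<Rightarrow> nat"
  assumes "clique_labelling V H c"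
  shows "capped_cover_number V H \<le> capped_cost V c"
  unfolding capped_cover_number_def using assms by (intro Least_le) auto

lemma ex_clique_labelling_capped_cover_number:
  assumes "finite V"
  shows "\<exists>c :: 'a \<Rightarrow> nat. clique_labelling V H c \<and> capped_cost V c = capped_cover_number V H"
  unfolding capped_cover_number_def
  using ex_clique_labelling_chromatic_number[OF assms, of H]
  by (intro LeastI_ex[where P = "\<lambda>k. \<exists>c :: 'a \<Rightarrow> nat. clique_labelling V H c \<and> capped_cost V c = k"]) blast

lemma capped_cover_number_le_twice_chromatic_number:
  assumes "finite V"
  shows "capped_cover_number V H \<le> 2 * chromatic_number V (vertex_pairs V - H)"
proof -
  obtain c :: "'a \<Rightarrow> nat" where c: "clique_labelling V H c"
    "card (c ` V) \<le> chromatic_number V (vertex_pairs V - H)"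
    using ex_clique_labelling_chromatic_number[OF assms] by blast
  have "capped_cost V c \<le> (\<Sum>i\<in>c ` V. 2)" unfolding capped_cost_def by (intro sum_mono) auto
  then show ?thesis using capped_cover_number_le[OF c(1)] c(2) by simp
qed

lemma chromatic_number_le_card:
  assumes "finite V"
  shows "chromatic_number V (vertex_pairs V - H) \<le> card V"
  using chromatic_number_le_card_labels[OF assms, of H "\<lambda>v. v"] by (simp add: clique_labelling_def)

lemma capped_cover_number_antimono:
  assumes "finite V" "H \<subseteq> H'"
  shows "capped_cover_number V H' \<le> capped_cover_number V H"
proof -
  obtain c :: "'a \<Rightarrow> nat" where c: "clique_labelling V H c" "capped_cost V c = capped_cover_number V H"
    using ex_clique_labelling_capped_cover_number[OF assms(1)] by blast
  then have "clique_labelling V H' c" using assms(2) by (auto simp: clique_labelling_def)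
  then show ?thesis using capped_cover_number_le c(2) by metis
qed

lemma capped_cost_superset:
  assumes "finite I" "c ` V \<subseteq> I"
  shows "capped_cost V c = (\<Sum>i\<in>I. min 2 (card (label_class V c i)))"
proof -
  have "label_class V c i = {}" if "i \<notin> c ` V" for i
    using that by (auto simp: label_class_def)
  then show ?thesis unfolding capped_cost_def
    by (intro sum.mono_neutral_left assms) auto
qed

text \<open>
  Giving \<open>u\<close> a fresh label creates a singleton, which costs 1, and shrinks the old class of
  \<open>u\<close> by one, which saves 1 if that class had at most two elements. So the split is free in
  that case.
\<close>
lemma capped_cost_split:
  assumes "finite V" "u \<in> V" "m \<notin> c ` V"
  shows "capped_cost V (c(u := m)) + min 2 (card (label_class V c (c u)))
    = capped_cost V c + min 2 (card (label_class V c (c u)) - 1) + 1"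
proof -
  define I where "I = c ` V - {c u}"
  have I: "c ` V = insert (c u) I" "c u \<notin> I" "m \<notin> I" "m \<noteq> c u" "finite I"
    using assms by (auto simp: I_def)
  have sub: "c ` V \<subseteq> insert m (insert (c u) I)" "(c(u := m)) ` V \<subseteq> insert m (insert (c u) I)"
    using I by auto
  have old: "label_class V c m = {}" using assms by (auto simp: label_class_def)
  have 1: "label_class V (c(u := m)) m = {u}" using assms by (auto simp: label_class_def)
  have 2: "label_class V (c(u := m)) (c u) = label_class V c (c u) - {u}"
    using I by (auto simp: label_class_def)
  have 3: "label_class V (c(u := m)) i = label_class V c i" if "i \<in> I" for i
    using I that by (auto simp: label_class_def)
  have "card (label_class V c (c u) - {u}) = card (label_class V c (c u)) - 1"
    using assms by (subst card_Diff_singleton) (auto simp: label_class_def)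
  then have "capped_cost V (c(u := m)) =
      1 + (min 2 (card (label_class V c (c u)) - 1) + (\<Sum>i\<in>I. min 2 (card (label_class V c i))))"
    using I capped_cost_superset[OF _ sub(2)] by (simp add: 1 2 3)
  moreover have "capped_cost V c =
      min 2 (card (label_class V c (c u))) + (\<Sum>i\<in>I. min 2 (card (label_class V c i)))"
    using I capped_cost_superset[OF _ sub(1)] by (simp add: old)
  ultimately show ?thesis by simp
qed

lemma clique_labelling_split:
  assumes "clique_labelling V H c" "m \<notin> c ` V"
  shows "clique_labelling V (H - {{u, v}}) (c(u := m))"
  using assms by (auto simp: clique_labelling_def doubleton_eq_iff split: if_splits)

text \<open>
  If one end of the removed edge is split off, the labelling no longer needs the edge.
\<close>
lemma capped_cover_number_remove_edge:
  assumes "finite V" "u \<in> V"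
  shows "capped_cover_number V (H - {{u, v}}) \<le> capped_cover_number V (insert {u, v} H) + 1"
proof -
  obtain c :: "'a \<Rightarrow> nat" where c: "clique_labelling V (insert {u, v} H) c"
    "capped_cost V c = capped_cover_number V (insert {u, v} H)"
    using ex_clique_labelling_capped_cover_number[OF assms(1)] by blast
  obtain m where m: "m \<notin> c ` V" using assms(1) ex_new_if_finite[of "c ` V"] by auto
  have "clique_labelling V (H - {{u, v}}) (c(u := m))"
    using clique_labelling_split[OF c(1) m, of u v] by simp
  from capped_cover_number_le[OF this] capped_cost_split[OF assms m] c(2)
  show ?thesis by (auto simp: min_def split: if_splits)
qed

text \<open>
  If the edge lies in no triangle, a class that contains both ends is just \<open>{u, v}\<close>, and
  splitting it into two singletons does not change the capped cost.
\<close>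
lemma capped_cover_number_remove_edge_no_triangle:
  assumes "finite V" "u \<in> V" "v \<in> V" "u \<noteq> v"
    and no: "\<And>w. w \<in> V - {u, v} \<Longrightarrow> {u, w} \<notin> H \<or> {v, w} \<notin> H"
  shows "capped_cover_number V (H - {{u, v}}) \<le> capped_cover_number V (insert {u, v} H)"
proof -
  obtain c :: "'a \<Rightarrow> nat" where c: "clique_labelling V (insert {u, v} H) c"
    "capped_cost V c = capped_cover_number V (insert {u, v} H)"
    using ex_clique_labelling_capped_cover_number[OF assms(1)] by blast
  show ?thesis
  proof (cases "c u = c v")
    case False
    then have "clique_labelling V (H - {{u, v}}) c"
      using c(1) unfolding clique_labelling_def by (metis Diff_iff doubleton_eq_iff insert_iff singletonD)
    then show ?thesis using capped_cover_number_le c(2) by metis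
  next
    case True
    have "w \<in> {u, v}" if "w \<in> V" "c w = c u" for w
    proof (rule ccontr)
      assume "w \<notin> {u, v}"
      then have "{u, w} \<in> H" "{v, w} \<in> H"
        using clique_labellingD[OF c(1), of u w] clique_labellingD[OF c(1), of v w] that True assms(2,3)
        by (auto simp: doubleton_eq_iff)
      then show False using no[of w] that \<open>w \<notin> {u, v}\<close> by auto
    qed
    then have "label_class V c (c u) = {u, v}"
      using True assms(2,3) by (auto simp: label_class_def)
    then have "card (label_class V c (c u)) = 2" using assms(4) by simp
    obtain m where m: "m \<notin> c ` V" using assms(1) ex_new_if_finite[of "c ` V"] by auto
    have "clique_labelling V (H - {{u, v}}) (c(u := m))"
      using clique_labelling_split[OF c(1) m, of u v] by simp
    from capped_cover_number_le[OF this] capped_cost_split[OF assms(1,2) m] c(2)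
    show ?thesis by (simp add: \<open>card (label_class V c (c u)) = 2\<close>)
  qed
qed

section \<open>Matchings in bipartite graphs with expansion\<close>

text \<open>
  The proof of Halmos and Vaughan: if some nonempty proper subset \<open>S\<close> is tight, match \<open>S\<close>
  within its neighbourhood and the rest outside of it; otherwise every such set has at least one
  neighbour to spare, and matching an arbitrary element arbitrarily uses up at most one.
\<close>
theorem hall_marriage:
  fixes N :: "'a \<Rightarrow> 'b set"
  assumes "finite A" "\<And>a. a \<in> A \<Longrightarrow> finite (N a)"
    and "\<And>S. S \<subseteq> A \<Longrightarrow> card S \<le> card (\<Union>(N ` S))"
  shows "\<exists>f. inj_on f A \<and> (\<forall>a\<in>A. f a \<in> N a)"
  using assms
proof (induction "card A" arbitrary: A N rule: less_induct)
  case less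
  show ?case
  proof (cases "A = {}")
    case True
    then show ?thesis by auto
  next
    case False
    show ?thesis
    proof (cases "\<exists>S. S \<subset> A \<and> S \<noteq> {} \<and> card (\<Union>(N ` S)) \<le> card S")
      case True
      then obtain S where S: "S \<subset> A" "S \<noteq> {}" "card (\<Union>(N ` S)) \<le> card S" by blast
      define D where "D = \<Union>(N ` S)"
      have fS: "finite S" using S less.prems(1) by (meson finite_subset psubset_imp_subset)
      have fD: "finite D" unfolding D_def using fS less.prems(2) S by auto
      have "\<exists>f. inj_on f S \<and> (\<forall>a\<in>S. f a \<in> N a)"
        using S less.prems fS by (intro less.hyps psubset_card_mono) auto
      then obtain f1 where f1: "inj_on f1 S" "\<forall>a\<in>S. f1 a \<in> N a" by blast
      have "\<exists>f. inj_on f (A - S) \<and> (\<forall>a\<in>A - S. f a \<in> N a - D)"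
      proof (intro less.hyps psubset_card_mono)
        fix T assume T: "T \<subseteq> A - S"
        have fT: "finite T" using T less.prems(1) finite_subset by blast
        have "card T + card S = card (T \<union> S)"
          using T fT fS by (subst card_Un_disjoint) auto
        also have "\<dots> \<le> card (\<Union>(N ` (T \<union> S)))" using T S by (intro less.prems(3)) auto
        also have "\<Union>(N ` (T \<union> S)) = D \<union> \<Union>((\<lambda>x. N x - D) ` T)" by (auto simp: D_def)
        also have "card \<dots> \<le> card D + card (\<Union>((\<lambda>x. N x - D) ` T))" by (rule card_Un_le)
        finally show "card T \<le> card (\<Union>((\<lambda>x. N x - D) ` T))" using S(3) D_def by simp
      qed (use S less.prems in auto)
      then obtain f2 where f2: "inj_on f2 (A - S)" "\<forall>a\<in>A - S. f2 a \<in> N a - D" by blast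
      define f where "f = (\<lambda>a. if a \<in> S then f1 a else f2 a)"
      have "f1 a \<in> D" if "a \<in> S" for a using f1 that by (auto simp: D_def)
      then have "inj_on f (S \<union> (A - S))"
        using f1 f2 unfolding inj_on_def f_def by (metis DiffE Diff_iff UnE)
      then have "inj_on f A" using S by (simp add: Un_absorb1 psubset_imp_subset)
      moreover have "\<forall>a\<in>A. f a \<in> N a" using f1 f2 by (auto simp: f_def)
      ultimately show ?thesis by blast
    next
      case nocrit: False
      obtain a where a: "a \<in> A" using False by blast
      have "card {a} \<le> card (N a)" using less.prems(3)[of "{a}"] a by simp
      then obtain b where b: "b \<in> N a" by fastforce
      have "\<exists>f. inj_on f (A - {a}) \<and> (\<forall>x\<in>A - {a}. f x \<in> N x - {b})"
      proof (intro less.hyps psubset_card_mono)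
        fix T assume T: "T \<subseteq> A - {a}"
        show "card T \<le> card (\<Union>((\<lambda>x. N x - {b}) ` T))"
        proof (cases "T = {}")
          case False
          moreover have "T \<subset> A" using T a by blast
          ultimately have "card T < card (\<Union>(N ` T))" using nocrit by (metis linorder_not_le)
          moreover have "\<Union>((\<lambda>x. N x - {b}) ` T) = \<Union>(N ` T) - {b}" by auto
          moreover have "card (\<Union>(N ` T)) - 1 \<le> card (\<Union>(N ` T) - {b})"
            by (metis card_Diff_singleton_if diff_le_self order_refl)
          ultimately show ?thesis by simp
        qed simp
      qed (use a less.prems in auto)
      then obtain f where f: "inj_on f (A - {a})" "\<forall>x\<in>A - {a}. f x \<in> N x - {b}" by blast
      have "inj_on (f(a := b)) A" using f by (auto simp: inj_on_def)
      moreover have "\<forall>x\<in>A. (f(a := b)) x \<in> N x" using f b by auto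
      ultimately show ?thesis by blast
    qed
  qed
qed

text \<open>
  If \<open>S\<close> had fewer neighbours than elements, these neighbours would lie in a set \<open>T\<close> of the
  same size as \<open>S\<close>, and the pair \<open>S\<close>, \<open>T\<close> would be too dense.
\<close>
lemma neighbourhood_expands:
  fixes d :: real
  assumes "finite X" "finite Y" "h \<le> card Y"
    and deg: "\<And>x. x \<in> X \<Longrightarrow> d \<le> card {y \<in> Y. {x, y} \<in> H}"
    and sparse: "\<And>S T. S \<subseteq> X \<Longrightarrow> T \<subseteq> Y \<Longrightarrow> card S = card T \<Longrightarrow> 0 < card S \<Longrightarrow> card S \<le> h
      \<Longrightarrow> (\<Sum>x\<in>S. real (card {y \<in> T. {x, y} \<in> H})) < d * card S"
    and S: "S \<subseteq> X" "card S \<le> h"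
  shows "card S \<le> card (\<Union>x\<in>S. {y \<in> Y. {x, y} \<in> H})"
proof (rule ccontr)
  let ?N = "\<Union>x\<in>S. {y \<in> Y. {x, y} \<in> H}"
  assume "\<not> ?thesis"
  then have less: "card ?N < card S" by simp
  then obtain T where T: "?N \<subseteq> T" "T \<subseteq> Y" "card T = card S"
    using exists_subset_between[of ?N "card S" Y] assms by fastforce
  have "d * card S = (\<Sum>x\<in>S. d)" by simp
  also have "\<dots> \<le> (\<Sum>x\<in>S. real (card {y \<in> T. {x, y} \<in> H}))"
  proof (rule sum_mono)
    fix x assume "x \<in> S"
    then have "{y \<in> T. {x, y} \<in> H} = {y \<in> Y. {x, y} \<in> H}" using T by auto
    then show "d \<le> real (card {y \<in> T. {x, y} \<in> H})" using deg \<open>x \<in> S\<close> S by auto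
  qed
  finally show False using sparse[of S T] S T less by fastforce
qed

text \<open>
  Expansion of sets of size at most \<open>h\<close>, about half of either side, is enough for Hall's
  condition: for a larger set \<open>S\<close> that violates it, the vertices of \<open>B\<close> outside the
  neighbourhood of \<open>S\<close> form a set of size at most \<open>h\<close> whose neighbours all lie in
  \<open>A - S\<close>, so that this set does not expand.
\<close>
lemma ex_bipartite_matching:
  fixes d :: real
  assumes fin: "finite A" "finite B" "card A \<le> card B" "h \<le> card A" "card B \<le> 2 * h"
    and degA: "\<And>x. x \<in> A \<Longrightarrow> d \<le> card {y \<in> B. {x, y} \<in> H}"
    and degB: "\<And>x. x \<in> B \<Longrightarrow> d \<le> card {y \<in> A. {x, y} \<in> H}"
    and sparse: "\<And>S T. S \<subseteq> A \<Longrightarrow> T \<subseteq> B \<Longrightarrow> card S = card T \<Longrightarrow> 0 < card S \<Longrightarrow> card S \<le> h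
      \<Longrightarrow> (\<Sum>x\<in>S. real (card {y \<in> T. {x, y} \<in> H})) < d * card S"
    and sparse': "\<And>S T. S \<subseteq> B \<Longrightarrow> T \<subseteq> A \<Longrightarrow> card S = card T \<Longrightarrow> 0 < card S \<Longrightarrow> card S \<le> h
      \<Longrightarrow> (\<Sum>x\<in>S. real (card {y \<in> T. {x, y} \<in> H})) < d * card S"
  shows "\<exists>f. inj_on f A \<and> (\<forall>a\<in>A. f a \<in> B \<and> {a, f a} \<in> H)"
proof -
  define N where "N = (\<lambda>a. {b \<in> B. {a, b} \<in> H})"
  define M where "M = (\<lambda>b. {a \<in> A. {b, a} \<in> H})"
  have expA: "card S \<le> card (\<Union>(N ` S))" if "S \<subseteq> A" "card S \<le> h" for S
    unfolding N_def
    by (rule neighbourhood_expands[where h = h and d = d, OF fin(1,2)];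
        (rule degA sparse that | use fin in linarith); assumption?)
  have expB: "card S \<le> card (\<Union>(M ` S))" if "S \<subseteq> B" "card S \<le> h" for S
    unfolding M_def
    by (rule neighbourhood_expands[where h = h and d = d, OF fin(2,1)];
        (rule degB sparse' that | use fin in linarith); assumption?)
  have "\<exists>f. inj_on f A \<and> (\<forall>a\<in>A. f a \<in> N a)"
  proof (rule hall_marriage)
    fix S assume S: "S \<subseteq> A"
    have fS: "finite S" using S fin finite_subset by blast
    have NB: "\<Union>(N ` S) \<subseteq> B" by (auto simp: N_def)
    show "card S \<le> card (\<Union>(N ` S))"
    proof (rule ccontr)
      assume less: "\<not> ?thesis"
      then have "h < card S" using expA[OF S] by (meson not_le)
      then obtain S' where S': "S' \<subseteq> S" "card S' = h" by (meson less_imp_le obtain_subset_with_card_n)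
      have "h \<le> card (\<Union>(N ` S'))" using expA[of S'] S S' by auto
      also have "\<dots> \<le> card (\<Union>(N ` S))"
        using S' NB fin by (intro card_mono) (auto intro: finite_subset)
      finally have large: "h \<le> card (\<Union>(N ` S))" .
      define R where "R = B - \<Union>(N ` S)"
      have cR: "card R = card B - card (\<Union>(N ` S))"
        unfolding R_def using NB fin by (meson card_Diff_subset finite_subset)
      have "card R \<le> card (\<Union>(M ` R))"
        using cR large fin by (intro expB) (auto simp: R_def)
      also have "\<dots> \<le> card (A - S)"
        using fin by (intro card_mono) (auto simp: M_def R_def N_def insert_commute)
      also have "\<dots> = card A - card S" using S fS by (simp add: card_Diff_subset)
      finally show False using cR less fin card_mono[OF fin(1) S] by linarith
    qed
  qed (use fin in \<open>auto simp: N_def\<close>)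
  then show ?thesis by (auto simp: N_def)
qed

text \<open>
  Only classes of size at least 3 are capped; every vertex in a smaller class costs 1.
\<close>
lemma capped_cost_eq_big_plus_small:
  assumes "finite V"
  shows "capped_cost V c = 2 * card {i \<in> c ` V. 3 \<le> card (label_class V c i)}
    + card {v \<in> V. card (label_class V c (c v)) \<le> 2}"
proof -
  let ?I = "{i \<in> c ` V. 3 \<le> card (label_class V c i)}"
  let ?J = "{i \<in> c ` V. card (label_class V c i) \<le> 2}"
  have IJ: "c ` V = ?I \<union> ?J" "?I \<inter> ?J = {}" by auto
  have "{v \<in> V. card (label_class V c (c v)) \<le> 2} = (\<Union>i\<in>?J. label_class V c i)"
    by (auto simp: label_class_def)
  then have small: "card {v \<in> V. card (label_class V c (c v)) \<le> 2} = (\<Sum>i\<in>?J. card (label_class V c i))"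
    using assms by (simp add: card_UN_disjoint label_class_def disjoint_iff)
  have "capped_cost V c = (\<Sum>i\<in>?I \<union> ?J. min 2 (card (label_class V c i)))"
    unfolding capped_cost_def by (rule sum.cong) (use IJ in auto)
  also have "\<dots> = (\<Sum>i\<in>?I. min 2 (card (label_class V c i))) + (\<Sum>i\<in>?J. min 2 (card (label_class V c i)))"
    by (rule sum.union_disjoint) (use assms in auto)
  also have "(\<Sum>i\<in>?I. min 2 (card (label_class V c i))) = (\<Sum>i\<in>?I. 2)"
    by (rule sum.cong) auto
  also have "(\<Sum>i\<in>?J. min 2 (card (label_class V c i))) = (\<Sum>i\<in>?J. card (label_class V c i))"
    by (rule sum.cong) auto
  finally show ?thesis using small by simp
qed

text \<open>
  The vertices in classes of size at most 2 can be relabelled along any matching of \<open>A\<close> into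
  \<open>B\<close>: one label for each element of \<open>B\<close> suffices.
\<close>
lemma chromatic_number_le_of_matching:
  assumes "finite V" "clique_labelling V H c"
    and U: "{v \<in> V. card (label_class V c (c v)) \<le> 2} = A \<union> B" "A \<inter> B = {}"
    and f: "inj_on f A" "\<forall>a\<in>A. f a \<in> B \<and> {a, f a} \<in> H"
  shows "chromatic_number V (vertex_pairs V - H)
    \<le> card {i \<in> c ` V. 3 \<le> card (label_class V c i)} + card B"
proof -
  let ?I = "{i \<in> c ` V. 3 \<le> card (label_class V c i)}"
  define g where "g v = (if v \<in> A then Inr (f v) else if v \<in> B then Inr v else Inl (c v))" for v
  have cl: "clique_labelling V H g"
    unfolding clique_labelling_def
  proof (intro ballI impI)
    fix u v assume uv: "u \<in> V" "v \<in> V" "u \<noteq> v" "g u = g v"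
    show "{u, v} \<in> H"
    proof (cases "u \<in> A \<or> u \<in> B")
      case True
      then show ?thesis
        using uv f U(2) by (auto simp: g_def inj_on_def insert_commute split: if_splits)
    next
      case False
      then have "c u = c v" using uv by (auto simp: g_def split: if_splits)
      then show ?thesis using uv assms(2) by (auto simp: clique_labelling_def)
    qed
  qed
  have "A \<union> B \<subseteq> V" using U(1) by auto
  then have "finite (A \<union> B)" using assms(1) finite_subset by blast
  then have fB: "finite B" by simp
  have "g ` V \<subseteq> Inl ` ?I \<union> Inr ` B"
  proof
    fix x assume "x \<in> g ` V"
    then obtain v where v: "v \<in> V" "x = g v" by blast
    show "x \<in> Inl ` ?I \<union> Inr ` B"
    proof (cases "v \<in> A \<union> B")
      case True
      then show ?thesis using f v by (auto simp: g_def)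
    next
      case False
      then have "\<not> card (label_class V c (c v)) \<le> 2" using U v by blast
      then show ?thesis using v False by (auto simp: g_def)
    qed
  qed
  then have "card (g ` V) \<le> card (Inl ` ?I \<union> Inr ` B :: ('b + 'a) set)"
    using assms(1) fB by (intro card_mono) auto
  also have "\<dots> \<le> card (Inl ` ?I :: ('b + 'a) set) + card (Inr ` B :: ('b + 'a) set)"
    by (rule card_Un_le)
  also have "\<dots> = card ?I + card B" by (simp add: card_image)
  finally show ?thesis using chromatic_number_le_card_labels[OF assms(1) cl] by simp
qed

section \<open>Pseudorandom graphs\<close>

definition triangle :: "'a \<Rightarrow> 'a \<Rightarrow> 'a \<Rightarrow> 'a set set" where
  "triangle x y z = {{x, y}, {y, z}, {x, z}}"

definition triangles :: "'a set \<Rightarrow> 'a set set set" where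
  "triangles V = {triangle x y z | x y z. x \<in> V \<and> y \<in> V \<and> z \<in> V \<and> distinct [x, y, z]}"

text \<open>
  The paw is the triangle with a pendant edge; here \<open>v\<close> is the vertex of degree 1. Disjoint
  paws at \<open>v\<close> witness neighbours of \<open>v\<close> in disjoint triangles that avoid \<open>v\<close>.
\<close>
definition paws :: "'a set \<Rightarrow> 'a \<Rightarrow> 'a set set set" where
  "paws V v = {insert {v, x} (triangle x y z) | x y z.
    x \<in> V \<and> y \<in> V \<and> z \<in> V \<and> distinct [v, x, y, z]}"

text \<open>
  The vertex set is cut at a threshold that depends on the graph. As these are only \<open>n + 1\<close>
  possible cuts, degrees into both sides can be controlled for all of them at once.
\<close>
definition initial_final_segments :: "nat \<Rightarrow> nat set set" where
  "initial_final_segments n = (\<lambda>t. {..<t}) ` {..n} \<union> (\<lambda>t. {t..<n}) ` {..n}"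

text \<open>
  The parameter \<open>\<nu>\<close> stands for the average degree \<open>n q\<close>. The first three conditions ensure
  that in any family of disjoint cliques with at least three vertices each, the cliques are small,
  and together cover few vertices and few neighbours of each vertex. The last two make the
  bipartite graph on the remaining vertices expand: degrees into a half are about
  \<open>\<nu> / 2\<close> and at least \<open>2/5 \<nu>\<close>, whereas the average degree between two sets of at most about \<open>n / 4\<close> vertices is at most about \<open>\<nu> / 4\<close> and below \<open>3/8 \<nu>\<close>. The gap
  between \<open>3/8\<close> and \<open>2/5\<close> absorbs the neighbours that are lost to larger cliques.
\<close>
definition pseudorandom :: "nat \<Rightarrow> real \<Rightarrow> nat set set \<Rightarrow> bool" where
  "pseudorandom n \<nu> H \<longleftrightarrow>
    (\<forall>K\<subseteq>{..<n}. card K = 5 \<longrightarrow> \<not> vertex_pairs K \<subseteq> H) \<and>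
    \<not> packs (triangles {..<n}) (nat \<lceil>real n / 1000\<rceil>) H \<and>
    (\<forall>v<n. \<not> packs (paws {..<n} v) (nat \<lceil>\<nu> / 1000\<rceil>) H) \<and>
    (\<forall>v<n. \<forall>I\<in>initial_final_segments n. v \<notin> I \<longrightarrow> 9/20 * real n \<le> card I \<longrightarrow>
      2/5 * \<nu> \<le> card {w \<in> I. {v, w} \<in> H}) \<and>
    (\<forall>S\<subseteq>{..<n}. \<forall>T\<subseteq>{..<n}. S \<inter> T = {} \<longrightarrow> card S = card T \<longrightarrow> 0 < card S \<longrightarrow>
      card S \<le> 13/50 * real n \<longrightarrow> (\<Sum>x\<in>S. real (card {y \<in> T. {x, y} \<in> H})) < 3/8 * \<nu> * card S)"

lemma ex_triangle_in_class:
  assumes "finite V" "clique_labelling V H c" "x \<in> V" "3 \<le> card (label_class V c (c x))"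
  shows "\<exists>y z. y \<in> V \<and> z \<in> V \<and> c y = c x \<and> c z = c x \<and> distinct [x, y, z] \<and> triangle x y z \<subseteq> H"
proof -
  have fin: "finite (label_class V c (c x))" using assms(1) by (auto simp: label_class_def)
  then have "2 \<le> card (label_class V c (c x) - {x})" using assms(4) by (auto simp: card_Diff_singleton_if)
  then obtain P where "P \<subseteq> label_class V c (c x) - {x}" "card P = 2"
    by (meson obtain_subset_with_card_n)
  then obtain y z where yz: "y \<noteq> z" "{y, z} \<subseteq> label_class V c (c x) - {x}" by (metis card_2_iff)
  then have "triangle x y z \<subseteq> H"
    using assms(2,3) by (auto simp: triangle_def label_class_def intro!: clique_labellingD[OF assms(2)])
  then show ?thesis using yz by (intro exI[of _ y] exI[of _ z]) (auto simp: label_class_def)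
qed

lemma card_label_class_less:
  assumes "clique_labelling V H c" "\<forall>K\<subseteq>V. card K = m \<longrightarrow> \<not> vertex_pairs K \<subseteq> H"
  shows "card (label_class V c i) < m"
proof (rule ccontr)
  assume "\<not> ?thesis"
  then obtain K where K: "K \<subseteq> label_class V c i" "card K = m"
    by (meson not_less obtain_subset_with_card_n)
  have "vertex_pairs K \<subseteq> H"
  proof
    fix e assume "e \<in> vertex_pairs K"
    then obtain x y where "e = {x, y}" "x \<noteq> y" "x \<in> K" "y \<in> K"
      by (auto simp: vertex_pairs_def card_2_iff)
    then show "e \<in> H" using K clique_labellingD[OF assms(1), of x y] by (auto simp: label_class_def)
  qed
  moreover have "K \<subseteq> V" using K by (auto simp: label_class_def)
  ultimately show False using assms(2) K by blast
qed

text \<open>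
  Picking one triangle in each class yields edge-disjoint triangles, as distinct classes have no
  vertex in common.
\<close>
lemma packs_triangles_of_classes:
  assumes "finite V" "clique_labelling V H c" "k \<le> card {i \<in> c ` V. 3 \<le> card (label_class V c i)}"
  shows "packs (triangles V) k H"
proof -
  let ?I = "{i \<in> c ` V. 3 \<le> card (label_class V c i)}"
  have "\<exists>F. F \<in> triangles V \<and> F \<subseteq> H \<and> F \<noteq> {} \<and> (\<forall>e\<in>F. e \<noteq> {} \<and> e \<subseteq> label_class V c i)"
    if i: "i \<in> ?I" for i
  proof -
    obtain x where x: "x \<in> V" "i = c x" using i by blast
    obtain y z where yz: "y \<in> V" "z \<in> V" "c y = c x" "c z = c x" "distinct [x, y, z]" "triangle x y z \<subseteq> H"
      using ex_triangle_in_class[OF assms(1,2) x(1)] x i by auto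
    then have "triangle x y z \<in> triangles V" using x unfolding triangles_def by blast
    moreover have "\<forall>e\<in>triangle x y z. e \<noteq> {} \<and> e \<subseteq> label_class V c i"
      using x yz by (auto simp: triangle_def label_class_def)
    moreover have "triangle x y z \<noteq> {}" by (simp add: triangle_def)
    ultimately show ?thesis using yz(6) by blast
  qed
  then obtain g where g: "\<And>i. i \<in> ?I \<Longrightarrow> g i \<in> triangles V \<and> g i \<subseteq> H \<and> g i \<noteq> {} \<and>
      (\<forall>e\<in>g i. e \<noteq> {} \<and> e \<subseteq> label_class V c i)" by metis
  show ?thesis
  proof (rule packsI[where I = ?I and g = g])
    fix i j assume ij: "i \<in> ?I" "j \<in> ?I" "i \<noteq> j"
    have "label_class V c i \<inter> label_class V c j = {}" using ij by (auto simp: label_class_def)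
    moreover have "e \<noteq> {}" "e \<subseteq> label_class V c i" if "e \<in> g i" for e
      using g[OF ij(1)] that by auto
    moreover have "e \<subseteq> label_class V c j" if "e \<in> g j" for e
      using g[OF ij(2)] that by auto
    ultimately show "g i \<inter> g j = {}" by (metis Int_greatest disjoint_iff subset_empty)
  qed (use assms g in auto)
qed

text \<open>
  Each big class other than that of \<open>v\<close> that contains a neighbour of \<open>v\<close> yields a paw at \<open>v\<close>.
  These paws are disjoint, since each edge of a paw has an end in the class from which the paw comes
  and its other end there or at \<open>v\<close>. So there are fewer than \<open>k\<close> such classes, with at most 4
  vertices each; the class of \<open>v\<close> accounts for the remaining 4 vertices.
\<close>
lemma card_big_neighbours_le:
  assumes "finite V" "clique_labelling V H c" "\<not> packs (paws V v) k H" "0 < k"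
    and small: "\<And>i. card (label_class V c i) \<le> 4"
  shows "card {w \<in> V. 3 \<le> card (label_class V c (c w)) \<and> {v, w} \<in> H} \<le> 4 * k"
proof -
  define I where "I = {i \<in> c ` V. 3 \<le> card (label_class V c i) \<and> i \<noteq> c v \<and> (\<exists>x\<in>V. c x = i \<and> {v, x} \<in> H)}"
  define P where "P i F \<longleftrightarrow> F \<in> paws V v \<and> F \<subseteq> H \<and> F \<noteq> {} \<and>
    (\<forall>e\<in>F. (\<exists>x\<in>e. c x = i) \<and> e \<subseteq> {x. x = v \<or> c x = i})" for i F
  have "\<exists>F. P i F" if i: "i \<in> I" for i
  proof -
    obtain x where x: "x \<in> V" "i = c x" "{v, x} \<in> H" "c x \<noteq> c v" using i by (auto simp: I_def)
    obtain y z where yz: "y \<in> V" "z \<in> V" "c y = c x" "c z = c x" "distinct [x, y, z]" "triangle x y z \<subseteq> H"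
      using ex_triangle_in_class[OF assms(1,2) x(1)] x i by (auto simp: I_def)
    then have "distinct [v, x, y, z]" using x by auto
    then have "insert {v, x} (triangle x y z) \<in> paws V v" using x yz unfolding paws_def by blast
    moreover have "\<forall>e\<in>insert {v, x} (triangle x y z). (\<exists>x\<in>e. c x = i) \<and> e \<subseteq> {x. x = v \<or> c x = i}"
      using x yz by (auto simp: triangle_def)
    moreover have "insert {v, x} (triangle x y z) \<subseteq> H" using x yz by simp
    ultimately have "P i (insert {v, x} (triangle x y z))" unfolding P_def by blast
    then show ?thesis by blast
  qed
  then obtain g where g: "\<And>i. i \<in> I \<Longrightarrow> P i (g i)" by metis
  have "card I < k"
  proof (rule ccontr)
    assume "\<not> ?thesis"
    then have "packs (paws V v) k H"
    proof (intro packsI[where I = I and g = g])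
      fix i j assume ij: "i \<in> I" "j \<in> I" "i \<noteq> j"
      show "g i \<inter> g j = {}"
      proof (rule ccontr)
        assume "g i \<inter> g j \<noteq> {}"
        then obtain e where e: "e \<in> g i" "e \<in> g j" by blast
        then obtain x where x: "x \<in> e" "c x = i" using g[OF ij(1)] unfolding P_def by blast
        then have "x = v \<or> c x = j" using e g[OF ij(2)] unfolding P_def by blast
        then show False using x ij by (auto simp: I_def)
      qed
    qed (use assms(1) g in \<open>auto simp: I_def P_def\<close>)
    then show False using assms(3) by simp
  qed
  have fin: "finite (label_class V c i)" for i using assms(1) by (simp add: label_class_def)
  have "{w \<in> V. 3 \<le> card (label_class V c (c w)) \<and> {v, w} \<in> H}
      \<subseteq> (\<Union>i\<in>I. label_class V c i) \<union> label_class V c (c v)"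
    by (auto simp: label_class_def I_def)
  then have "card {w \<in> V. 3 \<le> card (label_class V c (c w)) \<and> {v, w} \<in> H}
      \<le> card ((\<Union>i\<in>I. label_class V c i) \<union> label_class V c (c v))"
    using assms(1) fin by (intro card_mono) (auto simp: I_def)
  also have "\<dots> \<le> card (\<Union>i\<in>I. label_class V c i) + card (label_class V c (c v))"
    by (rule card_Un_le)
  also have "\<dots> \<le> (\<Sum>i\<in>I. card (label_class V c i)) + 4"
    using assms(1) by (intro add_mono card_UN_le small) (auto simp: I_def)
  also have "(\<Sum>i\<in>I. card (label_class V c i)) \<le> (\<Sum>i\<in>I. 4)"
    by (intro sum_mono small)
  finally show ?thesis using \<open>card I < k\<close> by simp
qed

text \<open>
  A discrete intermediate value theorem: the cardinality grows by at most one in each step.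
\<close>
lemma ex_initial_segment_of_card:
  "m \<le> card (U \<inter> {..<n}) \<Longrightarrow> \<exists>t\<le>n. card (U \<inter> {..<t :: nat}) = m"
proof (induction n)
  case (Suc n)
  show ?case
  proof (cases "m \<le> card (U \<inter> {..<n})")
    case True
    then show ?thesis using Suc.IH by (meson le_SucI)
  next
    case False
    have "card (U \<inter> {..<Suc n}) \<le> card (insert n (U \<inter> {..<n}))"
      by (intro card_mono) auto
    also have "\<dots> \<le> Suc (card (U \<inter> {..<n}))" by (simp add: card_insert_if)
    finally have "card (U \<inter> {..<Suc n}) = m" using Suc.prems False by simp
    then show ?thesis by blast
  qed
qed auto

lemma nat_less_nat_ceiling: "k < nat \<lceil>x :: real\<rceil> \<Longrightarrow> real k < x"
  by linarith

text \<open>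
  The surplus 1 is due to parity: if the number of vertices outside the big classes is odd, one of
  them remains single and still needs a whole colour.
\<close>
theorem twice_chromatic_number_le_capped_cover_number:
  assumes H: "pseudorandom n \<nu> H" and n: "1000 \<le> n" and \<nu>: "1000 \<le> \<nu>"
  shows "2 * chromatic_number {..<n} (vertex_pairs {..<n} - H) \<le> capped_cover_number {..<n} H + 1"
proof -
  let ?V = "{..<n}"
  obtain c :: "nat \<Rightarrow> nat" where c: "clique_labelling ?V H c" "capped_cost ?V c = capped_cover_number ?V H"
    using ex_clique_labelling_capped_cover_number[of ?V H] by auto
  let ?Big = "{i \<in> c ` ?V. 3 \<le> card (label_class ?V c i)}"
  define W where "W = {v \<in> ?V. 3 \<le> card (label_class ?V c (c v))}"
  define U where "U = {v \<in> ?V. card (label_class ?V c (c v)) \<le> 2}"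
  have K5: "\<forall>K\<subseteq>?V. card K = 5 \<longrightarrow> \<not> vertex_pairs K \<subseteq> H"
    and tri: "\<not> packs (triangles ?V) (nat \<lceil>real n / 1000\<rceil>) H"
    and paw: "\<And>v. v < n \<Longrightarrow> \<not> packs (paws ?V v) (nat \<lceil>\<nu> / 1000\<rceil>) H"
    and deg: "\<And>v I. v < n \<Longrightarrow> I \<in> initial_final_segments n \<Longrightarrow> v \<notin> I \<Longrightarrow> 9/20 * real n \<le> card I \<Longrightarrow>
      2/5 * \<nu> \<le> card {w \<in> I. {v, w} \<in> H}"
    and sparse: "\<And>S T. S \<subseteq> ?V \<Longrightarrow> T \<subseteq> ?V \<Longrightarrow> S \<inter> T = {} \<Longrightarrow> card S = card T \<Longrightarrow> 0 < card S \<Longrightarrow>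
      card S \<le> 13/50 * real n \<Longrightarrow> (\<Sum>x\<in>S. real (card {y \<in> T. {x, y} \<in> H})) < 3/8 * \<nu> * card S"
    using H unfolding pseudorandom_def by blast+
  have small: "card (label_class ?V c i) \<le> 4" for i
    using card_label_class_less[OF c(1) K5, of i] by simp
  have "card ?Big < nat \<lceil>real n / 1000\<rceil>"
    using packs_triangles_of_classes[OF _ c(1)] tri by (metis finite_lessThan not_le)
  then have Big: "real (card ?Big) < real n / 1000" by (rule nat_less_nat_ceiling)
  have "W = (\<Union>i\<in>?Big. label_class ?V c i)" by (auto simp: W_def label_class_def)
  then have "card W \<le> (\<Sum>i\<in>?Big. card (label_class ?V c i))" by (simp add: card_UN_le)
  also have "\<dots> \<le> (\<Sum>i\<in>?Big. 4)" by (intro sum_mono small)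
  finally have W: "real (card W) \<le> real n / 250" using Big by simp
  have "U = ?V - W" by (auto simp: U_def W_def)
  then have cU: "card U = n - card W" by (simp add: card_Diff_subset W_def Collect_conj_eq flip: lessThan_def)
  \<comment> \<open>the threshold \<open>t\<close> halves \<open>U\<close>; as \<open>U\<close> misses few vertices, both segments it cuts off
    have nearly \<open>n / 2\<close> vertices\<close>
  have "card U div 2 \<le> card (U \<inter> {..<n})" by (simp add: U_def Int_absorb2 subset_iff)
  then obtain t where t: "t \<le> n" "card (U \<inter> {..<t}) = card U div 2"
    using ex_initial_segment_of_card by blast
  define A where "A = U \<inter> {..<t}"
  define B where "B = U \<inter> {t..<n}"
  have AB: "U = A \<union> B" "A \<inter> B = {}" "finite A" "finite B" "A \<subseteq> ?V" "B \<subseteq> ?V"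
    using t by (auto simp: A_def B_def U_def)
  have cA: "card A = card U div 2" using t by (simp add: A_def)
  have cAB: "card A + card B = card U" using AB by (simp add: card_Un_disjoint)
  define h where "h = (card B + 1) div 2"
  have Wn: "card W \<le> n" using card_mono[of ?V W] by (auto simp: W_def)
  have "A \<subseteq> {..<t}" "B \<subseteq> {t..<n}" by (auto simp: A_def B_def)
  then have "card A \<le> t" "card B \<le> n - t"
    using card_mono[of "{..<t}" A] card_mono[of "{t..<n}" B] by auto
  moreover have "9/20 * real n \<le> card A" "9/20 * real n \<le> card B"
    using cA cAB cU W n Wn by linarith+
  ultimately have seg: "9/20 * real n \<le> card {..<t}" "9/20 * real n \<le> card {t..<n}"
    by simp_all
  have degI: "3/8 * \<nu> \<le> card {y \<in> U \<inter> I. {x, y} \<in> H}"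
    if "x < n" "I \<in> initial_final_segments n" "x \<notin> I" "9/20 * real n \<le> card I" for x I
  proof -
    have I: "I \<subseteq> ?V" using that(2) by (auto simp: initial_final_segments_def)
    then have fI: "finite I" using finite_subset by blast
    let ?WN = "{w \<in> ?V. 3 \<le> card (label_class ?V c (c w)) \<and> {x, w} \<in> H}"
    have "{w \<in> I. {x, w} \<in> H} \<subseteq> {y \<in> U \<inter> I. {x, y} \<in> H} \<union> ?WN"
      using I by (auto simp: U_def)
    then have "card {w \<in> I. {x, w} \<in> H} \<le> card ({y \<in> U \<inter> I. {x, y} \<in> H} \<union> ?WN)"
      using fI by (intro card_mono) auto
    also have "\<dots> \<le> card {y \<in> U \<inter> I. {x, y} \<in> H} + card ?WN" by (rule card_Un_le)
    also have "card ?WN \<le> 4 * nat \<lceil>\<nu> / 1000\<rceil>"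
      by (rule card_big_neighbours_le[OF _ c(1) paw[OF that(1)] _ small]) (use \<nu> in auto)
    finally have "card {w \<in> I. {x, w} \<in> H}
        \<le> card {y \<in> U \<inter> I. {x, y} \<in> H} + 4 * nat \<lceil>\<nu> / 1000\<rceil>" by simp
    then have "real (card {w \<in> I. {x, w} \<in> H})
        \<le> real (card {y \<in> U \<inter> I. {x, y} \<in> H} + 4 * nat \<lceil>\<nu> / 1000\<rceil>)"
      by (rule of_nat_mono)
    then have "real (card {w \<in> I. {x, w} \<in> H})
        \<le> real (card {y \<in> U \<inter> I. {x, y} \<in> H}) + 4 * real (nat \<lceil>\<nu> / 1000\<rceil>)"
      by (simp only: of_nat_add of_nat_mult of_nat_numeral)
    moreover have "real (nat \<lceil>\<nu> / 1000\<rceil>) \<le> \<nu> / 1000 + 1" using \<nu> by linarith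
    ultimately show ?thesis using deg[OF that] \<nu> by linarith
  qed
  have segs: "{..<t} \<in> initial_final_segments n" "{t..<n} \<in> initial_final_segments n"
    using t by (auto simp: initial_final_segments_def)
  have h: "real h \<le> 13/50 * real n"
    using cA cAB cU n unfolding h_def by linarith
  have "\<exists>f. inj_on f A \<and> (\<forall>a\<in>A. f a \<in> B \<and> {a, f a} \<in> H)"
  proof (rule ex_bipartite_matching[where h = h and d = "3/8 * \<nu>"])
    show "finite A" "finite B" by fact+
    show "card A \<le> card B" using cA cAB by linarith
    show "h \<le> card A" using cA cAB cU W n Wn unfolding h_def by linarith
    show "card B \<le> 2 * h" unfolding h_def by linarith
    show "3/8 * \<nu> \<le> card {y \<in> B. {x, y} \<in> H}" if "x \<in> A" for x
      using degI[OF _ segs(2) _ seg(2), of x] that t(1) by (auto simp: A_def B_def)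
    show "3/8 * \<nu> \<le> card {y \<in> A. {x, y} \<in> H}" if "x \<in> B" for x
      using degI[OF _ segs(1) _ seg(1), of x] that by (auto simp: A_def B_def)
    show "(\<Sum>x\<in>S. real (card {y \<in> T. {x, y} \<in> H})) < 3/8 * \<nu> * card S"
      if "S \<subseteq> A" "T \<subseteq> B" "card S = card T" "0 < card S" "card S \<le> h" for S T
      using that AB h by (intro sparse) auto
    show "(\<Sum>x\<in>S. real (card {y \<in> T. {x, y} \<in> H})) < 3/8 * \<nu> * card S"
      if "S \<subseteq> B" "T \<subseteq> A" "card S = card T" "0 < card S" "card S \<le> h" for S T
      using that AB h by (intro sparse) auto
  qed
  then obtain f where f: "inj_on f A" "\<forall>a\<in>A. f a \<in> B \<and> {a, f a} \<in> H" by blast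
  have "chromatic_number ?V (vertex_pairs ?V - H) \<le> card ?Big + card B"
    using chromatic_number_le_of_matching[OF _ c(1) _ AB(2) f] AB(1) by (simp add: U_def)
  moreover have "capped_cost ?V c = 2 * card ?Big + card U"
    using capped_cost_eq_big_plus_small[of ?V c] by (simp add: U_def)
  ultimately show ?thesis using c(2) cA cAB by linarith
qed

section \<open>Variance of the capped cover number\<close>

lemma finite_vertex_pairs: "finite V \<Longrightarrow> finite (vertex_pairs V)"
  by (rule finite_subset[of _ "Pow V"]) (auto simp: vertex_pairs_def)

lemma card_vertex_pairs: "finite V \<Longrightarrow> card (vertex_pairs V) = card V choose 2"
  unfolding vertex_pairs_def by (rule n_subsets)

lemma prob_bex_le_sum:
  fixes M :: "'a pmf"
  assumes "finite I" "\<And>i. i \<in> I \<Longrightarrow> measure_pmf.prob M {x. Q i x} \<le> b i"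
  shows "measure_pmf.prob M {x. \<exists>i\<in>I. Q i x} \<le> (\<Sum>i\<in>I. b i)"
proof -
  have "{x. \<exists>i\<in>I. Q i x} = (\<Union>i\<in>I. {x. Q i x})" by auto
  then have "measure_pmf.prob M {x. \<exists>i\<in>I. Q i x} \<le> (\<Sum>i\<in>I. measure_pmf.prob M {x. Q i x})"
    using measure_pmf.finite_measure_subadditive_finite[OF assms(1), of "\<lambda>i. {x. Q i x}" M] by simp
  also have "\<dots> \<le> (\<Sum>i\<in>I. b i)" by (intro sum_mono assms)
  finally show ?thesis .
qed

text \<open>
  Resampling the pair \<open>{u, v}\<close> matters only if \<open>u\<close> and \<open>v\<close> have a common neighbour \<open>w\<close>.
  Each \<open>w\<close> is one with probability \<open>q\<^sup>2\<close>, so each of the at most \<open>n\<^sup>2/2\<close> pairs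
  contributes at most \<open>q \<cdot> n q\<^sup>2\<close> to the Efron--Stein bound.
\<close>
lemma variance_capped_cover_number_le:
  fixes n :: nat and q :: real
  assumes q: "0 \<le> q" "q \<le> 1"
  shows "measure_pmf.variance (random_subset (vertex_pairs {..<n}) q) (\<lambda>H. real (capped_cover_number {..<n} H))
    \<le> (n * q) ^ 3 / 2"
proof -
  let ?V = "{..<n}"
  let ?\<mu> = "random_subset (vertex_pairs ?V) q"
  let ?\<psi> = "\<lambda>H. real (capped_cover_number ?V H)"
  have fin: "finite (vertex_pairs ?V)" by (simp add: finite_vertex_pairs)
  have one: "measure_pmf.expectation ?\<mu> (\<lambda>H. (?\<psi> (insert e H) - ?\<psi> (H - {e}))\<^sup>2) \<le> n * q\<^sup>2"
    if "e \<in> vertex_pairs ?V" for e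
  proof -
    obtain u v where uv: "e = {u, v}" "u \<noteq> v" "u \<in> ?V" "v \<in> ?V"
      using \<open>e \<in> vertex_pairs ?V\<close> by (auto simp: vertex_pairs_def card_2_iff)
    define T where "T = {H. \<exists>w\<in>?V - {u, v}. {{u, w}, {v, w}} \<subseteq> H}"
    have "(?\<psi> (insert e H) - ?\<psi> (H - {e}))\<^sup>2 \<le> indicator T H" for H
    proof -
      have anti: "?\<psi> (insert e H) \<le> ?\<psi> (H - {e})"
        by (intro of_nat_mono capped_cover_number_antimono) auto
      show ?thesis
      proof (cases "H \<in> T")
        case True
        have "capped_cover_number ?V (H - {e}) \<le> capped_cover_number ?V (insert e H) + 1"
          unfolding uv(1) by (intro capped_cover_number_remove_edge uv) simp
        then have "\<bar>?\<psi> (insert e H) - ?\<psi> (H - {e})\<bar> \<le> 1" using anti by linarith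
        then show ?thesis using True by (simp add: abs_square_le_1)
      next
        case False
        then have "capped_cover_number ?V (H - {e}) \<le> capped_cover_number ?V (insert e H)"
          unfolding uv(1) T_def
          by (intro capped_cover_number_remove_edge_no_triangle uv) auto
        then show ?thesis using anti False by simp
      qed
    qed
    then have "measure_pmf.expectation ?\<mu> (\<lambda>H. (?\<psi> (insert e H) - ?\<psi> (H - {e}))\<^sup>2)
        \<le> measure_pmf.expectation ?\<mu> (indicator T)"
      by (intro expectation_random_subset_mono fin)
    also have "\<dots> = measure_pmf.prob ?\<mu> T" by simp
    also have "\<dots> \<le> (\<Sum>w\<in>?V - {u, v}. q\<^sup>2)"
      unfolding T_def
    proof (rule prob_bex_le_sum)
      fix w assume w: "w \<in> ?V - {u, v}"
      then have "card {{u, w}, {v, w}} = 2" using uv by (auto simp: doubleton_eq_iff)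
      moreover have "{{u, w}, {v, w}} \<subseteq> vertex_pairs ?V"
        using w uv by (auto intro!: pair_in_vertex_pairs)
      ultimately show "measure_pmf.prob ?\<mu> {H. {{u, w}, {v, w}} \<subseteq> H} \<le> q\<^sup>2"
        using prob_subset_random_subset[OF fin q, of "{{u, w}, {v, w}}"] by simp
    qed simp
    also have "\<dots> = real (card (?V - {u, v})) * q\<^sup>2" by simp
    also have "\<dots> \<le> n * q\<^sup>2"
      using card_mono[of ?V "?V - {u, v}"] by (intro mult_right_mono) auto
    finally show ?thesis .
  qed
  have "measure_pmf.variance ?\<mu> ?\<psi> \<le> q * (1 - q) * (\<Sum>e\<in>vertex_pairs ?V.
      measure_pmf.expectation ?\<mu> (\<lambda>H. (?\<psi> (insert e H) - ?\<psi> (H - {e}))\<^sup>2))"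
    by (rule efron_stein_random_subset[OF fin q])
  also have "\<dots> \<le> q * 1 * (\<Sum>e\<in>vertex_pairs ?V. n * q\<^sup>2)"
    using q by (intro mult_mono sum_mono one sum_nonneg Bochner_Integration.integral_nonneg) auto
  also have "\<dots> = (n choose 2) * (n * q ^ 3)"
    by (simp add: card_vertex_pairs power2_eq_square power3_eq_cube)
  also have "\<dots> \<le> (real n)\<^sup>2 / 2 * (n * q ^ 3)"
  proof (rule mult_right_mono)
    have "2 * (n choose 2) \<le> n\<^sup>2" by (simp add: choose_two power2_eq_square algebra_simps)
    then have "real (2 * (n choose 2)) \<le> real (n\<^sup>2)" by (rule of_nat_mono)
    then show "real (n choose 2) \<le> (real n)\<^sup>2 / 2" by simp
  qed (use q in simp)
  also have "\<dots> = (n * q) ^ 3 / 2" by (simp add: power_mult_distrib power2_eq_square power3_eq_cube)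
  finally show ?thesis .
qed

section \<open>Sparse random graphs are pseudorandom\<close>

lemma exp_two_le_nine: "exp 2 \<le> (9 :: real)"
proof -
  have "exp 2 = exp 1 * exp (1 :: real)" by (simp flip: exp_add)
  also have "\<dots> \<le> 3 * 3" using exp_le by (intro mult_mono) auto
  finally show ?thesis by simp
qed

lemma triangles_subset: "triangles V \<subseteq> Pow (vertex_pairs V)"
  by (auto simp: triangles_def triangle_def vertex_pairs_def)

lemma paws_subset: "v \<in> V \<Longrightarrow> paws V v \<subseteq> Pow (vertex_pairs V)"
  by (auto simp: paws_def triangle_def vertex_pairs_def)

lemma card_triangle: "distinct [x, y, z] \<Longrightarrow> card (triangle x y z) = 3"
  by (auto simp: triangle_def doubleton_eq_iff card_insert_if)

lemma card_paw: "distinct [v, x, y, z] \<Longrightarrow> card (insert {v, x} (triangle x y z)) = 4"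
  by (auto simp: triangle_def doubleton_eq_iff card_insert_if)

lemma card_triangles_le:
  assumes "finite V" shows "card (triangles V) \<le> card V ^ 3"
proof -
  have "triangles V \<subseteq> (\<lambda>(x, y, z). triangle x y z) ` (V \<times> V \<times> V)"
    by (auto simp: triangles_def)
  then have "card (triangles V) \<le> card (V \<times> V \<times> V)"
    using assms by (meson card_image_le card_mono finite_SigmaI finite_imageI le_trans)
  then show ?thesis by (simp add: card_cartesian_product power3_eq_cube mult.assoc)
qed

lemma card_paws_le:
  assumes "finite V" shows "card (paws V v) \<le> card V ^ 3"
proof -
  have "paws V v \<subseteq> (\<lambda>(x, y, z). insert {v, x} (triangle x y z)) ` (V \<times> V \<times> V)"
    by (auto simp: paws_def)
  then have "card (paws V v) \<le> card (V \<times> V \<times> V)"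
    using assms by (meson card_image_le card_mono finite_SigmaI finite_imageI le_trans)
  then show ?thesis by (simp add: card_cartesian_product power3_eq_cube mult.assoc)
qed

text \<open>
  The conditions \<open>n\<^sup>-\<^sup>1 log n \<ll> q \<ll> n\<^sup>-\<^sup>2\<^sup>/\<^sup>3\<close> with explicit constants. The product
  \<open>n\<^sup>2 q\<^sup>3\<close> is, up to a constant factor, the expected number of triangles at a given vertex.
\<close>
context
  fixes n :: nat and q :: real
  assumes n: "1000 \<le> n" and q: "0 \<le> q" "q \<le> 1"
    and dense: "4000 * ln n \<le> n * q" and sparse: "(real n)\<^sup>2 * q ^ 3 \<le> 1 / 10000"
begin

abbreviation "cograph_pmf \<equiv> random_subset (vertex_pairs {..<n}) q"

text \<open>
  Apart from the bound for 5-cliques, the failure probabilities below come from terms of the form \<open>exp (- a n q)\<close> times a fixed power of \<open>n\<close>;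
  the lower bound on \<open>q\<close> turns the exponential into a negative power of \<open>n\<close>.
\<close>
lemma exp_le_of_dense:
  fixes k :: nat and a :: real
  assumes "k \<le> 4000 * a"
  shows "exp (- a * (n * q)) \<le> (1 / n) ^ k"
proof -
  have "k * ln n = k / 4000 * (4000 * ln n)" by simp
  also have "\<dots> \<le> k / 4000 * (n * q)" using dense by (intro mult_left_mono) auto
  also have "\<dots> \<le> a * (n * q)" using assms q by (intro mult_right_mono) auto
  finally have "exp (- a * (n * q)) \<le> exp (- (k * ln n))" by simp
  also have "\<dots> = (1 / n) ^ k"
    using n by (simp add: exp_minus exp_of_nat_mult power_one_over inverse_eq_divide)
  finally show ?thesis .
qed

text \<open>
  The expected number of 5-cliques is at most \<open>n\<^sup>5 q\<^sup>1\<^sup>0 = n\<^sup>-\<^sup>1 (n\<^sup>2 q\<^sup>3)\<^sup>3 q\<close>. For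
  4-cliques the corresponding bound \<open>n\<^sup>4 q\<^sup>6\<close> need not be as small as \<open>1 / n\<close>.
\<close>
lemma prob_five_clique:
  "measure_pmf.prob cograph_pmf {H. \<exists>K\<in>{K. K \<subseteq> {..<n} \<and> card K = 5}. vertex_pairs K \<subseteq> H} \<le> (1 / n) / 1000"
proof -
  have "measure_pmf.prob cograph_pmf {H. \<exists>K\<in>{K. K \<subseteq> {..<n} \<and> card K = 5}. vertex_pairs K \<subseteq> H}
      \<le> (\<Sum>K\<in>{K. K \<subseteq> {..<n} \<and> card K = 5}. q ^ 10)"
  proof (rule prob_bex_le_sum)
    fix K :: "nat set" assume K: "K \<in> {K. K \<subseteq> {..<n} \<and> card K = 5}"
    then have "card (vertex_pairs K) = 10"
      using card_vertex_pairs[of K] finite_subset[of K "{..<n}"] by (simp add: choose_two)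
    moreover have "vertex_pairs K \<subseteq> vertex_pairs {..<n}" using K by (auto simp: vertex_pairs_def)
    ultimately show "measure_pmf.prob cograph_pmf {H. vertex_pairs K \<subseteq> H} \<le> q ^ 10"
      using prob_subset_random_subset[OF finite_vertex_pairs q, of "{..<n}" "vertex_pairs K"] by simp
  qed simp
  also have "\<dots> = (n choose 5) * q ^ 10" using n_subsets[of "{..<n}" 5] by simp
  also have "\<dots> \<le> n ^ 5 * q ^ 10"
    using binomial_le_pow2[of n 5] binomial_fact_pow[of n 5] q
    by (intro mult_right_mono) (auto simp: fact_numeral simp flip: of_nat_power)
  also have "\<dots> = (1 / n) * (((real n)\<^sup>2 * q ^ 3) ^ 3 * q)"
    using n by (simp add: field_simps flip: power_mult power_add power_Suc power_Suc2) (simp add: eval_nat_numeral)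
  also have "((real n)\<^sup>2 * q ^ 3) ^ 3 * q \<le> (1 / 10000) ^ 3 * 1"
    using q sparse by (intro mult_mono power_mono) auto
  finally show ?thesis using n by (simp add: mult_left_mono field_simps)
qed

lemma prob_packs_triangles:
  "measure_pmf.prob cograph_pmf {H. packs (triangles {..<n}) (nat \<lceil>real n / 1000\<rceil>) H} \<le> (1 / n) ^ 4"
proof -
  have "exp 2 * (real (card (triangles {..<n})) * q ^ 3) \<le> 9 * (real n ^ 3 * q ^ 3)"
    using exp_two_le_nine q card_triangles_le[of "{..<n}"]
    by (intro mult_mono) (auto simp flip: of_nat_power)
  also have "\<dots> = 9 * n * ((real n)\<^sup>2 * q ^ 3)" by (simp add: power2_eq_square power3_eq_cube)
  also have "\<dots> \<le> 9 * n * (1 / 10000)" using sparse by (intro mult_left_mono) auto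
  also have "\<dots> \<le> nat \<lceil>real n / 1000\<rceil>" by linarith
  finally have "measure_pmf.prob cograph_pmf {H. packs (triangles {..<n}) (nat \<lceil>real n / 1000\<rceil>) H}
      \<le> exp (- real (nat \<lceil>real n / 1000\<rceil>))"
    by (intro prob_packs_le_exp[where r = 3] finite_vertex_pairs q triangles_subset)
       (auto simp: triangles_def card_triangle)
  also have "\<dots> \<le> exp (- (1 / 1000) * (n * q))"
  proof -
    have "n * q \<le> n" using mult_left_mono[of q 1 "real n"] q by simp
    then have "1 / 1000 * (n * q) \<le> real (nat \<lceil>real n / 1000\<rceil>)" by linarith
    then show ?thesis by simp
  qed
  also have "\<dots> \<le> (1 / n) ^ 4" by (rule exp_le_of_dense) auto
  finally show ?thesis .
qed

text \<open>
  The expected number of paws at \<open>v\<close> is at most \<open>n\<^sup>3 q\<^sup>4 = (n\<^sup>2 q\<^sup>3) \<cdot> n q\<close>, a small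
  fraction of the degree \<open>n q\<close>.
\<close>
lemma prob_packs_paws:
  "measure_pmf.prob cograph_pmf {H. \<exists>v\<in>{..<n}. packs (paws {..<n} v) (nat \<lceil>n * q / 1000\<rceil>) H} \<le> n * (1 / n) ^ 4"
proof -
  have one: "measure_pmf.prob cograph_pmf {H. packs (paws {..<n} v) (nat \<lceil>n * q / 1000\<rceil>) H} \<le> (1 / n) ^ 4"
    if v: "v \<in> {..<n}" for v
  proof -
    have "exp 2 * (real (card (paws {..<n} v)) * q ^ 4) \<le> 9 * (real n ^ 3 * q ^ 4)"
      using exp_two_le_nine q card_paws_le[of "{..<n}" v]
      by (intro mult_mono) (auto simp flip: of_nat_power)
    also have "\<dots> = 9 * (n * q) * ((real n)\<^sup>2 * q ^ 3)" by (simp add: eval_nat_numeral)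
    also have "\<dots> \<le> 9 * (n * q) * (1 / 10000)" using sparse q by (intro mult_left_mono) auto
    also have "\<dots> \<le> n * q / 1000" using q by simp
    also have "\<dots> \<le> nat \<lceil>n * q / 1000\<rceil>" by linarith
    finally have "measure_pmf.prob cograph_pmf {H. packs (paws {..<n} v) (nat \<lceil>n * q / 1000\<rceil>) H}
        \<le> exp (- real (nat \<lceil>n * q / 1000\<rceil>))"
      by (intro prob_packs_le_exp[where r = 4] finite_vertex_pairs q paws_subset v)
         (auto simp: paws_def card_paw)
    also have "\<dots> \<le> exp (- (1 / 1000) * (n * q))"
    proof -
      have "1 / 1000 * (n * q) \<le> real (nat \<lceil>n * q / 1000\<rceil>)" by linarith
      then show ?thesis by simp
    qed
    also have "\<dots> \<le> (1 / n) ^ 4" by (rule exp_le_of_dense) auto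
    finally show ?thesis .
  qed
  show ?thesis using prob_bex_le_sum[OF _ one, of "{..<n}" "\<lambda>v. v"] by simp
qed

lemma prob_low_degree:
  "measure_pmf.prob cograph_pmf {H. \<exists>(v, I)\<in>{..<n} \<times> initial_final_segments n.
      v \<notin> I \<and> 9/20 * real n \<le> card I \<and> \<not> 2/5 * (n * q) \<le> card {w \<in> I. {v, w} \<in> H}}
    \<le> n * (2 * (n + 1)) * (1 / n) ^ 4"
proof -
  have exp_tenth: "exp (- (1/10 :: real)) - 1 \<le> - (19/200)"
  proof -
    have "1 + 1/10 + (1/10)\<^sup>2 / 2 \<le> exp (1/10 :: real)" by (rule exp_lower_Taylor_quadratic) simp
    then show ?thesis by (simp add: exp_minus field_simps power2_eq_square)
  qed
  have one: "measure_pmf.prob cograph_pmf {H. v \<notin> I \<and> 9/20 * real n \<le> card I \<and>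
      \<not> 2/5 * (n * q) \<le> card {w \<in> I. {v, w} \<in> H}} \<le> (1 / n) ^ 4"
    if "v < n" "I \<in> initial_final_segments n" for v I
  proof (cases "v \<notin> I \<and> 9/20 * real n \<le> card I")
    case True
    have I: "I \<subseteq> {..<n}" using that(2) by (auto simp: initial_final_segments_def)
    have inj: "inj (\<lambda>w. {v, w})" by (auto simp: inj_def doubleton_eq_iff)
    define F where "F = (\<lambda>w. {v, w}) ` I"
    have F: "F \<subseteq> vertex_pairs {..<n}" "card F = card I"
      using True that I inj pair_in_vertex_pairs[of v "{..<n}"]
      by (auto simp: F_def card_image inj_on_subset)
    have count: "card (F \<inter> H) = card {w \<in> I. {v, w} \<in> H}" for H
    proof -
      have "F \<inter> H = (\<lambda>w. {v, w}) ` {w \<in> I. {v, w} \<in> H}" by (auto simp: F_def)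
      then show ?thesis using inj by (simp add: card_image inj_on_subset)
    qed
    \<comment> \<open>the multiplier \<open>- 1/10\<close> bounds the exponent by
      \<open>(- 19/200 \<cdot> 9/20 + 1/10 \<cdot> 2/5) n q = - 11/4000 n q\<close>\<close>
    have "measure_pmf.prob cograph_pmf {H. v \<notin> I \<and> 9/20 * real n \<le> card I \<and>
          \<not> 2/5 * (n * q) \<le> card {w \<in> I. {v, w} \<in> H}}
        \<le> measure_pmf.prob cograph_pmf {H. (- (1/10)) * (2/5 * (n * q)) \<le> (- (1/10)) * card (F \<inter> H)}"
      by (intro measure_pmf.finite_measure_mono) (auto simp: count not_less not_le mult_ac)
    also have "\<dots> \<le> exp (card F * q * (exp (- (1/10)) - 1) - (- (1/10)) * (2/5 * (n * q)))"
      by (intro chernoff_random_subset finite_vertex_pairs q F) simp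
    also have "\<dots> \<le> exp (- (1/400) * (n * q))"
    proof -
      have "9/20 * n * q \<le> card F * q" using True F q by (intro mult_right_mono) auto
      then have "card F * q * (19/200) \<ge> 9/20 * n * q * (19/200)" by (rule mult_right_mono) simp
      moreover have "card F * q * (exp (- (1/10)) - 1) \<le> card F * q * (- (19/200))"
        using exp_tenth q by (intro mult_left_mono) auto
      moreover have "0 \<le> n * q" using q by simp
      ultimately show ?thesis by (simp add: algebra_simps)
    qed
    also have "\<dots> \<le> (1 / n) ^ 4" by (rule exp_le_of_dense) auto
    finally show ?thesis .
  next
    case False
    then have "{H. v \<notin> I \<and> 9/20 * real n \<le> card I \<and>
      \<not> 2/5 * (n * q) \<le> card {w \<in> I. {v, w} \<in> H}} = {}" by blast
    then show ?thesis by (simp only: measure_empty) simp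
  qed
  have fin: "finite (initial_final_segments n)" by (simp add: initial_final_segments_def)
  have "card (initial_final_segments n) \<le> 2 * (n + 1)"
  proof -
    have "card (f ` {..n}) \<le> n + 1" for f :: "nat \<Rightarrow> nat set"
      using card_image_le[of "{..n}" f] by simp
    then have "card ((\<lambda>t. {..<t}) ` {..n} \<union> (\<lambda>t. {t..<n}) ` {..n}) \<le> (n + 1) + (n + 1)"
      by (intro order_trans[OF card_Un_le] add_mono)
    then show ?thesis by (simp add: initial_final_segments_def)
  qed
  then have "real (n * card (initial_final_segments n)) * (1 / n) ^ 4 \<le> real (n * (2 * (n + 1))) * (1 / n) ^ 4"
    by (intro mult_right_mono of_nat_mono mult_le_mono2) auto
  moreover have "measure_pmf.prob cograph_pmf {H. \<exists>(v, I)\<in>{..<n} \<times> initial_final_segments n.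
      v \<notin> I \<and> 9/20 * real n \<le> card I \<and> \<not> 2/5 * (n * q) \<le> card {w \<in> I. {v, w} \<in> H}}
     \<le> (\<Sum>p\<in>{..<n} \<times> initial_final_segments n. (1 / n) ^ 4)"
    using fin one by (intro prob_bex_le_sum) auto
  ultimately show ?thesis by (simp add: card_cartesian_product)
qed

text \<open>
  There are at most \<open>n\<^sup>2\<^sup>s\<close> pairs of sets of size \<open>s\<close>, and each is too dense with probability
  at most \<open>exp (- s n q / 80) \<le> n\<^sup>-\<^sup>5\<^sup>s\<close>.
\<close>
lemma prob_dense_pair:
  "measure_pmf.prob cograph_pmf {H. \<exists>s\<in>{1..n}. \<exists>(S, T)\<in>{S. S \<subseteq> {..<n} \<and> card S = s} \<times> {T. T \<subseteq> {..<n} \<and> card T = s}.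
      S \<inter> T = {} \<and> s \<le> 13/50 * real n \<and> \<not> (\<Sum>x\<in>S. real (card {y \<in> T. {x, y} \<in> H})) < 3/8 * (n * q) * s}
    \<le> n * (1 / n) ^ 3"
proof -
  have exp_quarter: "exp (1/4 :: real) - 1 \<le> 5/16"
    using exp_bound[of "1/4 :: real"] by (simp add: power2_eq_square)
  have one: "measure_pmf.prob cograph_pmf {H. S \<inter> T = {} \<and> s \<le> 13/50 * real n \<and>
      \<not> (\<Sum>x\<in>S. real (card {y \<in> T. {x, y} \<in> H})) < 3/8 * (n * q) * s} \<le> ((1 / n) ^ 5) ^ s"
    if ST: "S \<subseteq> {..<n}" "card S = s" "T \<subseteq> {..<n}" "card T = s" for s S T
  proof (cases "S \<inter> T = {} \<and> s \<le> 13/50 * real n")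
    case True
    have fin: "finite S" "finite T" using ST finite_subset by blast+
    have inj: "inj_on (\<lambda>(x, y). {x, y}) (S \<times> T)"
      using True by (auto simp: inj_on_def doubleton_eq_iff)
    define F where "F = (\<lambda>(x, y). {x, y}) ` (S \<times> T)"
    have "{x, y} \<in> vertex_pairs {..<n}" if "x \<in> S" "y \<in> T" for x y
      using that True ST by (intro pair_in_vertex_pairs) auto
    then have F: "F \<subseteq> vertex_pairs {..<n}" by (auto simp: F_def)
    have cF: "card F = s * s" using inj ST by (simp add: F_def card_image card_cartesian_product)
    have count: "card (F \<inter> H) = (\<Sum>x\<in>S. card {y \<in> T. {x, y} \<in> H})" for H
    proof -
      have "F \<inter> H = (\<lambda>(x, y). {x, y}) ` (SIGMA x:S. {y \<in> T. {x, y} \<in> H})" by (auto simp: F_def)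
      moreover have "inj_on (\<lambda>(x, y). {x, y}) (SIGMA x:S. {y \<in> T. {x, y} \<in> H})"
        by (rule inj_on_subset[OF inj]) auto
      ultimately show ?thesis using fin by (simp add: card_image)
    qed
    \<comment> \<open>the multiplier \<open>1/4\<close> bounds the exponent by
      \<open>(5/16 \<cdot> 13/50 - 1/4 \<cdot> 3/8) s n q = - 1/80 s n q\<close>\<close>
    have "measure_pmf.prob cograph_pmf {H. S \<inter> T = {} \<and> s \<le> 13/50 * real n \<and>
          \<not> (\<Sum>x\<in>S. real (card {y \<in> T. {x, y} \<in> H})) < 3/8 * (n * q) * s}
        \<le> measure_pmf.prob cograph_pmf {H. 1/4 * (3/8 * (n * q) * s) \<le> 1/4 * card (F \<inter> H)}"
      by (intro measure_pmf.finite_measure_mono) (auto simp: count not_less not_le mult_ac)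
    also have "\<dots> \<le> exp (card F * q * (exp (1/4) - 1) - 1/4 * (3/8 * (n * q) * s))"
      by (intro chernoff_random_subset finite_vertex_pairs q F) simp
    also have "\<dots> \<le> exp (- (1/80) * (n * q) * s)"
    proof -
      have "card F * q * (exp (1/4) - 1) \<le> card F * q * (5/16)"
        using exp_quarter q by (intro mult_left_mono) auto
      also have "\<dots> = s * (s * q) * (5/16)" by (simp add: cF)
      also have "\<dots> \<le> s * (13/50 * n * q) * (5/16)"
        using True q by (intro mult_right_mono mult_left_mono) auto
      finally show ?thesis by (simp add: algebra_simps)
    qed
    also have "\<dots> = exp (- (1/80) * (n * q)) ^ s"
      using exp_of_nat_mult[of s "- (1/80) * (n * q)"] by (simp add: mult.commute)
    also have "\<dots> \<le> ((1 / n) ^ 5) ^ s" by (intro power_mono exp_le_of_dense) auto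
    finally show ?thesis .
  next
    case False
    then have "{H. S \<inter> T = {} \<and> s \<le> 13/50 * real n \<and>
        \<not> (\<Sum>x\<in>S. real (card {y \<in> T. {x, y} \<in> H})) < 3/8 * (n * q) * s} = {}" by blast
    then show ?thesis by (simp only: measure_empty) simp
  qed
  have "measure_pmf.prob cograph_pmf {H. \<exists>s\<in>{1..n}. \<exists>(S, T)\<in>{S. S \<subseteq> {..<n} \<and> card S = s} \<times> {T. T \<subseteq> {..<n} \<and> card T = s}.
      S \<inter> T = {} \<and> s \<le> 13/50 * real n \<and> \<not> (\<Sum>x\<in>S. real (card {y \<in> T. {x, y} \<in> H})) < 3/8 * (n * q) * s}
    \<le> (\<Sum>s\<in>{1..n}. \<Sum>p\<in>{S. S \<subseteq> {..<n} \<and> card S = s} \<times> {T. T \<subseteq> {..<n} \<and> card T = s}. ((1 / n) ^ 5) ^ s)"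
    using one by (intro prob_bex_le_sum) auto
  also have "\<dots> = (\<Sum>s\<in>{1..n}. (real (n choose s) * real (n choose s)) * ((1 / n) ^ 5) ^ s)"
    using n_subsets[of "{..<n}"] by (simp add: card_cartesian_product)
  also have "\<dots> \<le> (\<Sum>s\<in>{1..n}. (1 / n) ^ 3)"
  proof (rule sum_mono)
    fix s assume s: "s \<in> {1..n}"
    have "real (n choose s) \<le> real n ^ s"
      using binomial_le_pow[of s n] s by (simp flip: of_nat_power)
    then have "(real (n choose s) * real (n choose s)) * ((1 / n) ^ 5) ^ s
        \<le> (real n ^ s * real n ^ s) * ((1 / n) ^ 5) ^ s"
      by (intro mult_right_mono mult_mono) auto
    also have "\<dots> = ((1 / n) ^ 3) ^ s"
      using n by (simp add: power_mult_distrib [symmetric] eval_nat_numeral)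
    also have "\<dots> \<le> ((1 / n) ^ 3) ^ 1"
      using s n by (intro power_decreasing) (auto intro!: power_le_one)
    finally show "(real (n choose s) * real (n choose s)) * ((1 / n) ^ 5) ^ s \<le> (1 / n) ^ 3" by simp
  qed
  finally show ?thesis by simp
qed

lemma prob_not_pseudorandom:
  "measure_pmf.prob cograph_pmf {H. \<not> pseudorandom n (n * q) H} \<le> 1 / n"
proof -
  let ?P = "measure_pmf.prob cograph_pmf"
  let ?B1 = "{H. \<exists>K\<in>{K. K \<subseteq> {..<n} \<and> card K = 5}. vertex_pairs K \<subseteq> H}"
  let ?B2 = "{H. packs (triangles {..<n}) (nat \<lceil>real n / 1000\<rceil>) H}"
  let ?B3 = "{H. \<exists>v\<in>{..<n}. packs (paws {..<n} v) (nat \<lceil>n * q / 1000\<rceil>) H}"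
  let ?B4 = "{H. \<exists>(v, I)\<in>{..<n} \<times> initial_final_segments n.
      v \<notin> I \<and> 9/20 * real n \<le> card I \<and> \<not> 2/5 * (n * q) \<le> card {w \<in> I. {v, w} \<in> H}}"
  let ?B5 = "{H. \<exists>s\<in>{1..n}. \<exists>(S, T)\<in>{S. S \<subseteq> {..<n} \<and> card S = s} \<times> {T. T \<subseteq> {..<n} \<and> card T = s}.
      S \<inter> T = {} \<and> s \<le> 13/50 * real n \<and> \<not> (\<Sum>x\<in>S. real (card {y \<in> T. {x, y} \<in> H})) < 3/8 * (n * q) * s}"
  have "{H. \<not> pseudorandom n (n * q) H} \<subseteq> ?B1 \<union> (?B2 \<union> (?B3 \<union> (?B4 \<union> ?B5)))"
  proof (rule subsetI, rule ccontr)
    fix H assume H: "H \<in> {H. \<not> pseudorandom n (n * q) H}"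
      and "H \<notin> ?B1 \<union> (?B2 \<union> (?B3 \<union> (?B4 \<union> ?B5)))"
    then have B: "H \<notin> ?B1" "H \<notin> ?B2" "H \<notin> ?B3" "H \<notin> ?B4" "H \<notin> ?B5" by blast+
    have "pseudorandom n (n * q) H"
      unfolding pseudorandom_def
    proof (intro conjI allI ballI impI)
      show "\<not> vertex_pairs K \<subseteq> H" if "K \<subseteq> {..<n}" "card K = 5" for K
        using B(1) that by blast
      show "\<not> packs (triangles {..<n}) (nat \<lceil>real n / 1000\<rceil>) H" using B(2) by blast
      show "\<not> packs (paws {..<n} v) (nat \<lceil>n * q / 1000\<rceil>) H" if "v < n" for v
        using B(3) that by blast
      show "2/5 * (n * q) \<le> card {w \<in> I. {v, w} \<in> H}"
        if "v < n" "I \<in> initial_final_segments n" "v \<notin> I" "9/20 * real n \<le> card I" for v I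
        using B(4) that by blast
      show "(\<Sum>x\<in>S. real (card {y \<in> T. {x, y} \<in> H})) < 3/8 * (n * q) * card S"
        if ST: "S \<subseteq> {..<n}" "T \<subseteq> {..<n}" "S \<inter> T = {}" "card S = card T" "0 < card S"
          "card S \<le> 13/50 * real n" for S T
      proof (rule ccontr)
        assume dense: "\<not> ?thesis"
        have "card S \<in> {1..n}" using ST card_mono[of "{..<n}" S] by auto
        moreover have "(S, T) \<in> {S'. S' \<subseteq> {..<n} \<and> card S' = card S} \<times> {T. T \<subseteq> {..<n} \<and> card T = card S}"
          using ST by auto
        ultimately show False using B(5) ST(3,6) dense by blast
      qed
    qed
    then show False using H by simp
  qed
  then have "?P {H. \<not> pseudorandom n (n * q) H} \<le> ?P (?B1 \<union> (?B2 \<union> (?B3 \<union> (?B4 \<union> ?B5))))"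
    by (intro measure_pmf.finite_measure_mono) auto
  also have "\<dots> \<le> ?P ?B1 + (?P ?B2 + (?P ?B3 + (?P ?B4 + ?P ?B5)))"
    by (intro order_trans[OF measure_Un_le] add_left_mono) auto
  also have "\<dots> \<le> (1 / n) / 1000 + ((1 / n) ^ 4 + (n * (1 / n) ^ 4 + (n * (2 * (n + 1)) * (1 / n) ^ 4 + n * (1 / n) ^ 3)))"
    by (intro add_mono prob_five_clique prob_packs_triangles prob_packs_paws prob_low_degree prob_dense_pair)
  also have "\<dots> \<le> 1 / n"
  proof -
    define y where "y = 1 / real n"
    have y: "0 \<le> y" "y \<le> 1 / 1000" "real n * y = 1" using n by (auto simp: y_def field_simps)
    have yy: "y * y \<le> y / 1000" using mult_left_mono[OF y(2) y(1)] by simp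
    have y3: "y ^ 3 \<le> y / 1000"
      using mult_mono[OF yy, of y 1] y by (simp add: power3_eq_cube)
    have y4: "y ^ 4 \<le> y / 1000"
      using mult_mono[OF yy, of "y * y" 1] y mult_le_one[of y y] by (simp add: eval_nat_numeral mult.assoc)
    have "real n * y ^ 4 = y ^ 3" "real n * y ^ 3 = y * y" "real n * real n * y ^ 4 = y * y"
      using y(3) by (simp_all add: eval_nat_numeral) (simp_all add: mult.assoc[symmetric] mult.commute)
    moreover have "n * (2 * (n + 1)) * y ^ 4 = 2 * (real n * real n * y ^ 4) + 2 * (real n * y ^ 4)"
      by (simp add: algebra_simps)
    ultimately show ?thesis using y y3 y4 yy unfolding y_def[symmetric] by linarith
  qed
  finally show ?thesis .
qed

section \<open>Concentration\<close>

text \<open>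
  Off the exceptional event \<open>0 \<le> 2 \<chi> - \<psi> \<le> 1\<close>, and the means differ by
  \<open>0 \<le> 2 E \<chi> - E \<psi> \<le> 3\<close>. So a deviation of \<open>\<chi>\<close> by \<open>C s\<close> forces one of \<open>\<psi>\<close>
  by at least \<open>2 C s - 3 \<ge> C s\<close>.
\<close>
lemma concentration_chromatic_number_cograph:
  fixes C :: real
  assumes C: "3 \<le> C"
  defines "chr \<equiv> \<lambda>H. real (chromatic_number {..<n} (vertex_pairs {..<n} - H))"
  shows "measure_pmf.prob cograph_pmf
      {H. \<bar>chr H - measure_pmf.expectation cograph_pmf chr\<bar> \<ge> C * sqrt ((n * q) ^ 3)}
    \<le> 1 / n + 1 / (2 * C\<^sup>2)"
proof -
  define \<psi> where "\<psi> = (\<lambda>H. real (capped_cover_number {..<n} H))"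
  let ?P = "measure_pmf.prob cograph_pmf"
  let ?E = "measure_pmf.expectation cograph_pmf"
  let ?Bad = "{H. \<not> pseudorandom n (n * q) H}"
  define s where "s = sqrt ((n * q) ^ 3)"
  have fin: "finite (vertex_pairs {..<n})" by (simp add: finite_vertex_pairs)
  have \<nu>: "1000 \<le> n * q"
  proof -
    have "exp 1 \<le> real n" using exp_le n by linarith
    then have "1 \<le> ln (real n)" using n by (simp add: ln_ge_iff)
    then show ?thesis using dense by linarith
  qed
  have s: "1 \<le> s" "s\<^sup>2 = (n * q) ^ 3"
  proof -
    have "1 \<le> (n * q) ^ 3" using \<nu> by (intro one_le_power) linarith
    then show "1 \<le> s" "s\<^sup>2 = (n * q) ^ 3" using \<nu> by (simp_all add: s_def)
  qed
  have lower: "\<psi> H \<le> 2 * chr H" for H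
    using of_nat_mono[OF capped_cover_number_le_twice_chromatic_number[of "{..<n}" H], where 'a = real]
    by (simp add: \<psi>_def chr_def)
  have good: "2 * chr H \<le> \<psi> H + 1" if "H \<notin> ?Bad" for H
  proof -
    have "pseudorandom n (n * q) H" using that by simp
    from of_nat_mono[OF twice_chromatic_number_le_capped_cover_number[OF this n \<nu>], where 'a = real]
    show ?thesis by (simp add: \<psi>_def chr_def)
  qed
  have upper: "2 * chr H \<le> \<psi> H + 1 + 2 * real n * indicator ?Bad H" for H
  proof (cases "H \<in> ?Bad")
    case True
    have "chr H \<le> n"
      using chromatic_number_le_card[of "{..<n}" H] by (simp add: chr_def)
    moreover have "0 \<le> \<psi> H" by (simp add: \<psi>_def)
    ultimately show ?thesis using True by simp
  next
    case False
    then show ?thesis using good[OF False] by simp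
  qed
  have "?E \<psi> \<le> ?E (\<lambda>H. 2 * chr H)"
    using lower by (intro expectation_random_subset_mono fin)
  then have mean_lower: "?E \<psi> \<le> 2 * ?E chr" by simp
  \<comment> \<open>the exceptional event contributes at most \<open>2 n \<cdot> 1/n\<close>, which is where its probability
    has to be \<open>O(1/n)\<close> and not merely small\<close>
  have "?E (\<lambda>H. 2 * chr H) \<le> ?E (\<lambda>H. \<psi> H + 1 + 2 * real n * indicator ?Bad H)"
    using upper by (intro expectation_random_subset_mono fin)
  also have "\<dots> = ?E \<psi> + 1 + 2 * n * ?P ?Bad"
    using fin by simp
  also have "\<dots> \<le> ?E \<psi> + 1 + 2 * n * (1 / n)"
    by (intro add_left_mono mult_left_mono prob_not_pseudorandom) auto
  finally have mean_upper: "2 * ?E chr \<le> ?E \<psi> + 3" using n by simp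
  have "{H. \<bar>chr H - ?E chr\<bar> \<ge> C * s} \<subseteq> ?Bad \<union> {H \<in> space cograph_pmf. \<bar>\<psi> H - ?E \<psi>\<bar> \<ge> C * s}"
  proof
    fix H assume H: "H \<in> {H. \<bar>chr H - ?E chr\<bar> \<ge> C * s}"
    have "3 \<le> C * s" using mult_mono[OF C s(1)] C by simp
    then have "C * s \<le> \<bar>\<psi> H - ?E \<psi>\<bar>" if "H \<notin> ?Bad"
      using H good[OF that] lower[of H] mean_lower mean_upper by (simp only: mem_Collect_eq)
    then show "H \<in> ?Bad \<union> {H \<in> space cograph_pmf. \<bar>\<psi> H - ?E \<psi>\<bar> \<ge> C * s}" by auto
  qed
  then have "?P {H. \<bar>chr H - ?E chr\<bar> \<ge> C * s}
      \<le> ?P (?Bad \<union> {H \<in> space cograph_pmf. \<bar>\<psi> H - ?E \<psi>\<bar> \<ge> C * s})"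
    by (intro measure_pmf.finite_measure_mono) auto
  also have "\<dots> \<le> ?P ?Bad + ?P {H \<in> space cograph_pmf. \<bar>\<psi> H - ?E \<psi>\<bar> \<ge> C * s}"
    by (intro measure_Un_le) auto
  also have "\<dots> \<le> 1 / n + measure_pmf.variance cograph_pmf \<psi> / (C * s)\<^sup>2"
    using C s fin by (intro add_mono prob_not_pseudorandom measure_pmf.Chebyshev_inequality) auto
  also have "\<dots> \<le> 1 / n + ((n * q) ^ 3 / 2) / (C * s)\<^sup>2"
    using variance_capped_cover_number_le[OF q] unfolding \<psi>_def
    by (intro add_left_mono divide_right_mono) auto
  also have "((n * q) ^ 3 / 2) / (C * s)\<^sup>2 = 1 / (2 * C\<^sup>2)"
  proof -
    have "x / 2 / (C\<^sup>2 * x) = 1 / (2 * C\<^sup>2)" if "0 < x" for x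
      using that C by (simp add: field_simps)
    moreover have "0 < (n * q) ^ 3" using \<nu> by (intro zero_less_power) linarith
    ultimately show ?thesis by (simp only: power_mult_distrib[of C s] s(2))
  qed
  finally show ?thesis unfolding s_def .
qed

lemma concentration_chromatic_number_gnp:
  fixes C :: real
  assumes C: "3 \<le> C"
  shows "measure_pmf.prob (gnp n (1 - q))
      {E. \<bar>real (chromatic_number {..<n} E)
          - measure_pmf.expectation (gnp n (1 - q)) (\<lambda>F. real (chromatic_number {..<n} F))\<bar>
        \<ge> C * sqrt ((n * q) ^ 3)}
    \<le> 1 / n + 1 / (2 * C\<^sup>2)"
proof -
  have "gnp n (1 - q) = map_pmf ((-) (vertex_pairs {..<n})) cograph_pmf"
    unfolding random_subset_compl[OF finite_vertex_pairs[OF finite_lessThan] q]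
    by (simp add: gnp_def random_subset_def)
  then show ?thesis
    using concentration_chromatic_number_cograph[OF C] by (simp add: vimage_def)
qed

end

text \<open>
  By Chebyshev's inequality it suffices that \<open>1 / (2 C\<^sup>2) \<le> \<epsilon> / 2\<close>; the other half of \<open>\<epsilon>\<close>
  absorbs the probability \<open>1 / n\<close> of the exceptional event.
\<close>
theorem theorem1p1:
  fixes \<epsilon> :: real
  assumes "\<epsilon> > 0"
  shows "\<exists>C::real. \<forall>p q :: nat \<Rightarrow> real.
    (\<forall>n. 0 \<le> p n \<and> p n \<le> 1) \<longrightarrow>
    (\<forall>n. q n = 1 - p n) \<longrightarrow>
    (\<lambda>n. ln (real n) / real n) \<in> o(q) \<longrightarrow>
    q \<in> o(\<lambda>n. real n powr (- 2 / 3)) \<longrightarrow>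
    (\<forall>\<^sub>F n in sequentially.
      measure_pmf.prob (gnp n (p n))
        {E. \<bar>real (chromatic_number {..<n} E)
              - measure_pmf.expectation (gnp n (p n)) (\<lambda>F. real (chromatic_number {..<n} F))\<bar>
            \<ge> C * real n powr (3 / 2) * q n powr (3 / 2)} \<le> \<epsilon>)"
proof (intro exI allI impI)
  define C where "C = max 3 (1 / sqrt \<epsilon>)"
  have C: "3 \<le> C" "1 / (2 * C\<^sup>2) \<le> \<epsilon> / 2"
  proof -
    have "(1 / sqrt \<epsilon>)\<^sup>2 \<le> C\<^sup>2" using assms by (intro power_mono) (auto simp: C_def)
    then have "1 / \<epsilon> \<le> C\<^sup>2" using assms by (simp add: power_divide)
    moreover have "0 < C\<^sup>2" by (simp add: C_def)
    ultimately show "1 / (2 * C\<^sup>2) \<le> \<epsilon> / 2" using assms by (simp add: field_simps)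
  qed (simp add: C_def)
  fix p q :: "nat \<Rightarrow> real"
  assume p: "\<forall>n. 0 \<le> p n \<and> p n \<le> 1" and pq: "\<forall>n. q n = 1 - p n"
    and lower: "(\<lambda>n. ln (real n) / real n) \<in> o(q)" and upper: "q \<in> o(\<lambda>n. real n powr (- 2 / 3))"
  have "\<forall>\<^sub>F n in sequentially. norm (ln (real n) / real n) \<le> 1 / 4000 * norm (q n)"
    using landau_o.smallD[OF lower, of "1 / 4000"] by simp
  moreover have "\<forall>\<^sub>F n in sequentially. norm (q n) \<le> 1 / 100 * norm (real n powr (- 2 / 3))"
    using landau_o.smallD[OF upper, of "1 / 100"] by simp
  moreover have "\<forall>\<^sub>F n in sequentially. max 1000 (nat \<lceil>2 / \<epsilon>\<rceil>) \<le> n"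
    by (rule eventually_ge_at_top)
  ultimately show "\<forall>\<^sub>F n in sequentially.
      measure_pmf.prob (gnp n (p n))
        {E. \<bar>real (chromatic_number {..<n} E)
              - measure_pmf.expectation (gnp n (p n)) (\<lambda>F. real (chromatic_number {..<n} F))\<bar>
            \<ge> C * real n powr (3 / 2) * q n powr (3 / 2)} \<le> \<epsilon>"
  proof eventually_elim
    case (elim n)
    have n: "1000 \<le> n" "2 / \<epsilon> \<le> n" using elim(3) by linarith+
    have q: "0 \<le> q n" "q n \<le> 1" and "p n = 1 - q n" using p pq by auto
    have dense: "4000 * ln n \<le> n * q n"
      using elim(1) n q by (simp add: field_simps abs_if split: if_splits)
    have sparse: "(real n)\<^sup>2 * q n ^ 3 \<le> 1 / 10000"
    proof -
      have "q n ^ 3 \<le> (1 / 100 * real n powr (- 2 / 3)) ^ 3"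
        using elim(2) q by (intro power_mono) auto
      also have "\<dots> = 1 / 1000000 * real n powr (- 2)"
        using n by (simp add: power_mult_distrib powr_power power_divide)
      also have "real n powr (- 2) = 1 / (real n)\<^sup>2"
        using n by (simp add: powr_minus divide_inverse)
      finally show ?thesis using n by (simp add: field_simps)
    qed
    have scale: "sqrt ((n * q n) ^ 3) = real n powr (3 / 2) * q n powr (3 / 2)"
    proof -
      have "sqrt ((n * q n) ^ 3) = ((n * q n) powr 3) powr (1 / 2)"
        using q by (simp add: powr_half_sqrt)
      also have "\<dots> = (n * q n) powr (3 / 2)" by (simp only: powr_powr) simp
      finally show ?thesis using q by (simp add: powr_mult)
    qed
    have "measure_pmf.prob (gnp n (1 - q n))
        {E. \<bar>real (chromatic_number {..<n} E)
              - measure_pmf.expectation (gnp n (1 - q n)) (\<lambda>F. real (chromatic_number {..<n} F))\<bar>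
            \<ge> C * sqrt ((n * q n) ^ 3)} \<le> 1 / n + 1 / (2 * C\<^sup>2)"
      by (rule concentration_chromatic_number_gnp[OF n(1) q dense sparse C(1)])
    also have "\<dots> \<le> \<epsilon> / 2 + \<epsilon> / 2"
      using n assms C(2) by (intro add_mono) (auto simp: field_simps)
    finally show ?case unfolding \<open>p n = 1 - q n\<close> mult.assoc scale[symmetric] by simp
  qed
qed

end
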